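(* Let $\mathbb{T}=(t_{k,n})_{0\le k\le n,\ n\in\mathbb{P}}$ be a triangular array of real numbers with $t_{k,n}\ge0$ for all $0\le k\le n$, $t_{k,n}\le t_{k+1,n}$ for all $0\le k<n$, and $\sum_{k=0}^nt_{k,n}=1$ for all $n\in\mathbb{P}$. Let $\omega=(\omega_n)$ be a nondecreasing sequence of positive integers with $\omega_n\to\infty$ and $|n|/\omega_n\to\infty$ as $n\to\infty$. If $$\lim_{(k,n)_{\Delta_\omega}\to\infty}\frac{\widetilde T_{2^k,n}}{\widetilde T_{2^{k-1},n}}=1,$$ then there exists a function $f_0\in L_1(\mathbb{I})$ such that $$\limsup_{n\to\infty}\bigl|\mathcal{T}_n^{\mathbb{T}}(f_0;x)\bigr|=\infty$$ at every point $x\in\mathbb{I}$.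
   Context: Notation: $\mathbb{P}=\{1,2,\dots\}$, $\mathbb{N}=\mathbb{P}\cup\{0\}$, $\mathbb{I}=[0,1)$ with Lebesgue measure. For $n\in\mathbb{N}$ write $n=\sum_{j\ge0}\varepsilon_j(n)2^j$ with $\varepsilon_j(n)\in\{0,1\}$; for $n\in\mathbb{P}$, $|n|:=\max\{s:\varepsilon_s(n)=1\}$. Each $x\in\mathbb{I}$ is written $x=\sum_{j\ge0}x_j2^{-(j+1)}$, $x_j\in\{0,1\}$ (terminating expansion for dyadic rationals); $r_k(x)=(-1)^{x_k}$ and $w_n=\prod_{k\ge0}r_k^{\varepsilon_k(n)}$ is the Walsh--Paley system. For $f\in L_1(\mathbb{I})$, $\widehat f(k)=\int_{\mathbb{I}}fw_k$ and $S_n(f;x)=\sum_{k=0}^{n-1}\widehat f(k)w_k(x)$. The matrix transform is $\mathcal{T}_n^{\mathbb{T}}(f;x):=\sum_{k=1}^nt_{k,n}S_k(f;x)$, $n\in\mathbb{P}$. For $n\in\mathbb{P}$ and $0\le s\le|n|$, $\widetilde T_{2^s,n}:=\sum_{l=0}^{2^s-1}t_{n-l,n}$. $\Delta_\omega:=\{(k,n)\in\mathbb{N}\times\mathbb{P}:|n|-\omega_n<k\le|n|\}$, and $\lim_{(k,n)_{\Delta_\omega}\to\infty}a_k(n)=L$ means: for every $\varepsilon>0$ there is $N_0$ such that $|a_k(n)-L|<\varepsilon$ whenever $(k,n)\in\Delta_\omega$ and $|n|\ge N_0$. *)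

theory Defs
  imports "HOL-Analysis.Analysis"
begin

definition top_bit :: "nat \<Rightarrow> nat"  \<comment> \<open>the order |n|, meaningful for n > 0 only\<close>
  where "top_bit n = Max {s. bit n s}"

text \<open>
  Binary digits of x in [0,1). The floor formula selects the terminating expansion for
  dyadic rationals; see the three lemmas below.
\<close>

definition digit :: "nat \<Rightarrow> real \<Rightarrow> nat"
  where "digit k x = nat (\<lfloor>2 ^ (k + 1) * x\<rfloor> mod 2)"

lemma digit_range: "digit k x \<in> {0, 1}"
  by (auto simp: digit_def)

lemma digit_sums:
  assumes "x \<in> {0..<1}"
  shows "(\<lambda>j. real (digit j x) / 2 ^ (j + 1)) sums x"
proof -
  have partial: "(\<Sum>j<m. real (digit j x) / 2 ^ (j + 1)) = of_int \<lfloor>2 ^ m * x\<rfloor> / 2 ^ m" for m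
  proof (induction m)
    case 0
    have "\<lfloor>x\<rfloor> = 0" using assms by (simp add: floor_eq_iff)
    then show ?case by simp
  next
    case (Suc m)
    have "\<lfloor>2 ^ Suc m * x\<rfloor> div 2 = \<lfloor>2 ^ m * x\<rfloor>"
      using floor_divide_real_eq_div[of 2 "2 ^ Suc m * x"] by simp
    then have "\<lfloor>2 ^ Suc m * x\<rfloor> = 2 * \<lfloor>2 ^ m * x\<rfloor> + int (digit m x)"
      using mult_div_mod_eq[of 2 "\<lfloor>2 ^ Suc m * x\<rfloor>"] by (simp add: digit_def)
    then have "real_of_int \<lfloor>2 ^ Suc m * x\<rfloor> = 2 * of_int \<lfloor>2 ^ m * x\<rfloor> + real (digit m x)"
      by (metis of_int_add of_int_mult of_int_numeral of_int_of_nat_eq)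
    with Suc show ?case by (simp add: field_simps)
  qed
  have "(\<lambda>m. of_int \<lfloor>2 ^ m * x\<rfloor> / 2 ^ m) \<longlonglongrightarrow> x"
  proof (rule tendsto_sandwich)
    show "\<forall>\<^sub>F m in sequentially. x - (1 / 2) ^ m \<le> of_int \<lfloor>2 ^ m * x\<rfloor> / 2 ^ m"
    proof (rule always_eventually, rule allI)
      fix m
      have "2 ^ m * x - 1 \<le> of_int \<lfloor>2 ^ m * x\<rfloor>" by linarith
      then have "(2 ^ m * x - 1) / 2 ^ m \<le> of_int \<lfloor>2 ^ m * x\<rfloor> / 2 ^ m"
        by (intro divide_right_mono) auto
      then show "x - (1 / 2) ^ m \<le> of_int \<lfloor>2 ^ m * x\<rfloor> / 2 ^ m"
        by (simp add: diff_divide_distrib power_one_over)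
    qed
    show "\<forall>\<^sub>F m in sequentially. of_int \<lfloor>2 ^ m * x\<rfloor> / 2 ^ m \<le> x"
      by (auto simp: field_simps intro!: always_eventually)
    have "(\<lambda>m. x - (1 / 2) ^ m) \<longlonglongrightarrow> x - 0"
      by (intro tendsto_diff tendsto_const LIMSEQ_power_zero) simp
    then show "(\<lambda>m. x - (1 / 2) ^ m) \<longlonglongrightarrow> x" by simp
  qed simp
  then show ?thesis by (simp only: sums_def partial)
qed

lemma digit_dyadic:
  assumes "m \<le> j"
  shows "digit j (of_int a / 2 ^ m) = 0"
proof -
  have "(2::real) ^ (j + 1) = 2 * 2 ^ (j - m) * 2 ^ m"
    using assms by (simp flip: power_add)
  then have "2 ^ (j + 1) * (of_int a / 2 ^ m) = real_of_int (2 * (2 ^ (j - m) * a))"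
    by simp
  then have "\<lfloor>2 ^ (j + 1) * (of_int a / 2 ^ m) :: real\<rfloor> = 2 * (2 ^ (j - m) * a)"
    by (metis floor_of_int)
  then show ?thesis by (simp add: digit_def)
qed

definition rademacher :: "nat \<Rightarrow> real \<Rightarrow> real"
  where "rademacher k x = (- 1) ^ digit k x"

text \<open>The factors with vanishing binary digit are 1, so the infinite product is finite.\<close>

definition walsh :: "nat \<Rightarrow> real \<Rightarrow> real"
  where "walsh n x = (\<Prod>k | bit n k. rademacher k x)"

definition walsh_coeff :: "(real \<Rightarrow> real) \<Rightarrow> nat \<Rightarrow> real"
  where "walsh_coeff f k = (LINT x:{0..<1}|lebesgue. f x * walsh k x)"

definition walsh_sum :: "nat \<Rightarrow> (real \<Rightarrow> real) \<Rightarrow> real \<Rightarrow> real"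
  where "walsh_sum n f x = (\<Sum>k<n. walsh_coeff f k * walsh k x)"

text \<open>An entry written t with indices (k,n) is rendered as \<open>t k n\<close>.\<close>

definition matrix_transform :: "(nat \<Rightarrow> nat \<Rightarrow> real) \<Rightarrow> nat \<Rightarrow> (real \<Rightarrow> real) \<Rightarrow> real \<Rightarrow> real"
  where "matrix_transform t n f x = (\<Sum>k = 1..n. t k n * walsh_sum k f x)"

definition tail_sum :: "(nat \<Rightarrow> nat \<Rightarrow> real) \<Rightarrow> nat \<Rightarrow> nat \<Rightarrow> real"
  where "tail_sum t m n = (\<Sum>l<m. t (n - l) n)"

definition Delta :: "(nat \<Rightarrow> nat) \<Rightarrow> (nat \<times> nat) set"
  where "Delta \<omega> = {(k, n). n \<ge> 1 \<and> int (top_bit n) - int (\<omega> n) < int k \<and> k \<le> top_bit n}"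

text \<open>
  The index set may contain pairs with k = 0 for small |n|, where an expression in k - 1 such as
  \<open>tail_sum t (2 ^ (k - 1)) n\<close> is a truncation artefact. If |n| / \<open>\<omega> n\<close> tends to infinity,
  no such pair has large |n|, so the limit below is unaffected.
\<close>

definition has_Delta_limit :: "(nat \<Rightarrow> nat) \<Rightarrow> (nat \<Rightarrow> nat \<Rightarrow> real) \<Rightarrow> real \<Rightarrow> bool"
  where "has_Delta_limit \<omega> a L \<longleftrightarrow>
    (\<forall>\<epsilon>>0. \<exists>N\<^sub>0. \<forall>(k, n)\<in>Delta \<omega>. top_bit n \<ge> N\<^sub>0 \<longrightarrow> \<bar>a k n - L\<bar> < \<epsilon>)"

end

theory Submission imports Defs begin

text \<open>
  Write T(m, n) for the sum of the last m weights of row n. The hypothesis on the quotients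
  T(2^k, n) / T(2^(k - 1), n) says that the weights pile up at the end of each row: for every fixed A
  one has T(2^(|n| - A), n) \<rightarrow> 1 (\<open>tail_mass\<close>). Indeed halving the window A times costs A
  factors close to 1, and the window of length 2^|n| itself misses almost nothing, because by
  monotonicity the weights further left are dominated by those in its left half, whose sum is
  T(2^|n|, n) - T(2^(|n| - 1), n).

  Hence the transform behaves like a partial sum on dilated functions. If g is a Walsh polynomial
  with 2^R coefficients and f(x) = g(2^M x), then all frequencies of f are multiples of 2^M, so
  S_k f is constant for k in a window of length 2^M that ends at n = 2^M p. For M large, nearly all
  of the mass of row n sits in that window, and the transform at n is close to S_p g at the point
  2^M x. So it suffices to find nonnegative Walsh polynomials g with mean 1 such that
  the maximum over p of |S_p g(y)| is as large as desired at every point y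
  (\<open>exists_spike\<close>): on a sum of their dilates with weights 2^(-j) and rapidly growing sizes and
  dilations, the transform is then unbounded at every point.

  The polynomials come from the dyadic version of Kolmogorov's construction. Let g be the average
  of 2^n point masses, one in each dyadic interval of length 2^(-n). If the binary digits of y and of
  an atom first differ at position s, then the Dirichlet kernel D_p at that pair is of size about 2^s
  for a suitable p. There are 2^(n - 1 - s) such atoms, so each s < n contributes a constant to the
  average of the absolute values, and altogether they are of order n. The signs of
  these terms are controlled by giving every atom private high binary digits: switching the
  corresponding bit of p changes the sign of the term of that atom alone.
\<close>

section \<open>Walsh functions of a sequence of signs\<close>

text \<open>
  A Walsh function depends on x only through the Rademacher signs u j = r_j(x). Keeping the signs u
  as the argument makes dilation (a shift of u) and dyadic translation (a pointwise
  product of sign sequences) visible in the algebra.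
\<close>

definition sign_walsh :: "(nat \<Rightarrow> real) \<Rightarrow> nat \<Rightarrow> real"
  where "sign_walsh u k = (\<Prod>j | bit k j. u j)"

definition dirichlet :: "(nat \<Rightarrow> real) \<Rightarrow> nat \<Rightarrow> real"
  where "dirichlet u p = (\<Sum>k<p. sign_walsh u k)"

lemma bit_imp_power_le: "bit (k::nat) j \<Longrightarrow> 2 ^ j \<le> k"
  by (metis bit_iff_odd div_less even_zero linorder_not_less)

lemma finite_bits: "finite {j. bit (k::nat) j}"
proof (rule finite_subset)
  show "{j. bit k j} \<subseteq> {..k}"
  proof
    fix j assume "j \<in> {j. bit k j}"
    then have "2 ^ j \<le> k" by (simp add: bit_imp_power_le)
    then show "j \<in> {..k}" using less_exp[of j] by (meson atMost_iff less_imp_le order_trans)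
  qed
qed simp

lemma sign_walsh_0 [simp]: "sign_walsh u 0 = 1"
  by (simp add: sign_walsh_def)

text \<open>
  The lowest bit of k is split off. All recursions below follow the binary expansion in this way, from
  the lowest bit upwards, with the signs shifted by one place.
\<close>

lemma sign_walsh_rec: "sign_walsh u k = (if odd k then u 0 else 1) * sign_walsh (\<lambda>j. u (Suc j)) (k div 2)"
proof -
  have "{j. bit k j} = (if odd k then {0} else {}) \<union> Suc ` {j. bit (k div 2) j}"
  proof (rule set_eqI)
    fix j show "j \<in> {j. bit k j} \<longleftrightarrow> j \<in> (if odd k then {0} else {}) \<union> Suc ` {j. bit (k div 2) j}"
      by (cases j) (auto simp: bit_0 bit_Suc)
  qed
  moreover have "prod u ((if odd k then {0} else {}) \<union> Suc ` {j. bit (k div 2) j})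
    = prod u (if odd k then {0} else {}) * prod u (Suc ` {j. bit (k div 2) j})"
    by (rule prod.union_disjoint) (auto simp: finite_bits)
  ultimately show ?thesis
    by (simp add: sign_walsh_def prod.reindex)
qed

lemma sign_walsh_double: "sign_walsh u (2 * k) = sign_walsh (\<lambda>j. u (Suc j)) k"
  by (subst sign_walsh_rec) simp

text \<open>
  Multiplying the frequency by 2^M dilates the function by 2^M, that is, it shifts the signs.
\<close>

lemma sign_walsh_shift: "sign_walsh u (2 ^ M * k) = sign_walsh (\<lambda>j. u (M + j)) k"
  by (induction M arbitrary: u) (simp_all add: mult.assoc sign_walsh_double)

lemma sign_walsh_abs: "(\<And>j. \<bar>u j\<bar> = 1) \<Longrightarrow> \<bar>sign_walsh u k\<bar> = 1"
  by (simp add: sign_walsh_def abs_prod)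

lemma sign_walsh_mult: "sign_walsh (\<lambda>j. u j * v j) k = sign_walsh u k * sign_walsh v k"
  by (simp add: sign_walsh_def prod.distrib)

lemma sign_walsh_xor:
  assumes "\<And>j. u j * u j = 1"
  shows "sign_walsh u k * sign_walsh u l = sign_walsh u (semiring_bit_operations_class.xor k l)"
proof -
  let ?K = "{j. bit k j}" and ?L = "{j. bit l j}"
  have "{j. bit (semiring_bit_operations_class.xor k l) j} = (?K - ?L) \<union> (?L - ?K)"
    by (auto simp: bit_xor_iff)
  then have "sign_walsh u (semiring_bit_operations_class.xor k l) = prod u (?K - ?L) * prod u (?L - ?K)"
    unfolding sign_walsh_def by (simp, subst prod.union_disjoint) (auto simp: finite_bits)
  moreover have "sign_walsh u k = prod u (?K \<inter> ?L) * prod u (?K - ?L)"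
    unfolding sign_walsh_def by (subst prod.Int_Diff[of _ _ ?L]) (auto simp: finite_bits)
  moreover have "sign_walsh u l = prod u (?K \<inter> ?L) * prod u (?L - ?K)"
    unfolding sign_walsh_def by (subst prod.Int_Diff[of _ _ ?K]) (auto simp: finite_bits Int_commute)
  moreover have "prod u (?K \<inter> ?L) * prod u (?K \<inter> ?L) = 1"
    by (simp add: assms flip: prod.distrib)
  ultimately show ?thesis
    by (simp add: ac_simps)
qed

lemma dirichlet_Suc: "dirichlet u (Suc p) = dirichlet u p + sign_walsh u p"
  by (simp add: dirichlet_def)

lemma dirichlet_double: "dirichlet u (2 * p) = (1 + u 0) * dirichlet (\<lambda>j. u (Suc j)) p"
proof (induction p)
  case (Suc p)
  have "sign_walsh u (Suc (2 * p)) = u 0 * sign_walsh (\<lambda>j. u (Suc j)) p"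
    by (subst sign_walsh_rec) simp
  with Suc show ?case
    using sign_walsh_double[of u p] by (simp add: dirichlet_Suc distrib_left distrib_right)
qed (simp add: dirichlet_def)

lemma dirichlet_rec:
  "dirichlet u p = (1 + u 0) * dirichlet (\<lambda>j. u (Suc j)) (p div 2)
    + (if odd p then sign_walsh (\<lambda>j. u (Suc j)) (p div 2) else 0)"
proof (cases "even p")
  case True
  then obtain q where "p = 2 * q" by blast
  then show ?thesis by (simp add: dirichlet_double)
next
  case False
  then obtain q where "p = Suc (2 * q)" by (auto elim: oddE)
  then show ?thesis by (simp add: dirichlet_Suc dirichlet_double sign_walsh_double)
qed

text \<open>
  The kernel factors as the product of 1 + u j over j < R.
\<close>

lemma dirichlet_power_nonneg:
  assumes "\<And>j. \<bar>u j\<bar> = 1"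
  shows "0 \<le> dirichlet u (2 ^ R)"
  using assms
proof (induction R arbitrary: u)
  case 0
  then show ?case by (simp add: dirichlet_def)
next
  case (Suc R)
  have "0 \<le> 1 + u 0" using Suc.prems[of 0] by linarith
  then show ?case
    using Suc.IH[of "\<lambda>j. u (Suc j)"] Suc.prems by (simp add: dirichlet_double)
qed

text \<open>
  The closed form of the Walsh--Dirichlet kernel. The kernel is the p-th Walsh function times the sum of
  \<open>\<epsilon>_k(p) r_k D_(2^k)\<close>. Up to the first sign change s the factor D_(2^k) is 2^k, beyond it
  D_(2^k) vanishes, and r_s = -1 makes the term of bit s negative. The resulting number is
  p reduced to s + 1 bits with the highest bit counted negatively, which is the two's complement reading
  \<open>signed_take_bit s p\<close>. If p < 2^s, no bit reaches a sign change and the value is p.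
\<close>

lemma dirichlet_first_change:
  assumes "\<And>j. j < s \<Longrightarrow> u j = 1" and "u s = - 1 \<or> p < 2 ^ s"
  shows "dirichlet u p = sign_walsh u p * of_int (signed_take_bit s (int p))"
  using assms
proof (induction s arbitrary: u p)
  case 0
  show ?case
  proof (cases "p = 0")
    case False
    with 0 have "u 0 = -1" by auto
    then show ?thesis
      by (subst dirichlet_rec, subst sign_walsh_rec) (auto simp: mod_2_eq_odd)
  qed (simp add: dirichlet_def)
next
  case (Suc s)
  have IH: "dirichlet (\<lambda>j. u (Suc j)) (p div 2) =
    sign_walsh (\<lambda>j. u (Suc j)) (p div 2) * of_int (signed_take_bit s (int (p div 2)))"
    using Suc.prems by (intro Suc.IH) auto
  have "u 0 = 1" using Suc.prems by simp
  then show ?case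
    unfolding dirichlet_rec[of u p] sign_walsh_rec[of u p] IH
    by (cases "odd p") (simp_all add: signed_take_bit_Suc zdiv_int mod_2_eq_odd distrib_left)
qed


text \<open>
  If bit s - 1 is set and bit s is not, the value is at least 2^(s - 1); in the opposite case the value is
  -2^s plus terms below 2^(s - 1). For s = 0 the bit must be set. An alternating pattern of bits that
  starts with 1 thus makes the kernels for all s large simultaneously.
\<close>

lemma signed_take_bit_large:
  assumes "case s of 0 \<Rightarrow> bit p 0 | Suc r \<Rightarrow> bit p s \<noteq> bit p r"
  shows "2 ^ s \<le> 2 * \<bar>signed_take_bit s (int p)\<bar>"
proof (cases s)
  case 0
  with assms have "odd p" by (simp add: bit_0)
  with 0 show ?thesis by (simp add: signed_take_bit_0 mod_2_eq_odd)
next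
  case (Suc r)
  have *: "take_bit s (int p) = take_bit r (int p) + (if bit p r then 2 ^ r else 0)"
    using Suc by (simp add: take_bit_Suc_from_most bit_of_nat_iff_bit)
  have "0 \<le> take_bit r (int p)" "take_bit r (int p) < 2 ^ r" by simp_all
  moreover have "signed_take_bit s (int p) = take_bit r (int p) + (if bit p r then 2 ^ r else 0)
      - (if bit p s then 2 ^ s else 0)"
    using * by (simp add: signed_take_bit_eq_take_bit_minus bit_of_nat_iff_bit take_bit_Suc_from_most Suc)
  moreover have "(2::int) ^ s = 2 * 2 ^ r" using Suc by simp
  moreover have "bit p s \<noteq> bit p r" using assms Suc by simp
  ultimately show ?thesis by (smt (verit))
qed


lemma exists_with_bits: "\<exists>p::nat. p < 2 ^ R \<and> (\<forall>j. bit p j \<longleftrightarrow> j < R \<and> b j)"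
proof (intro exI conjI allI)
  let ?p = "horner_sum of_bool 2 (map b [0..<R]) :: nat"
  show "?p < 2 ^ R"
    using horner_sum_of_bool_2_less[of "map b [0..<R]", where 'a = nat]
    unfolding length_map length_upt by (simp only: diff_zero)
  show "bit ?p j \<longleftrightarrow> j < R \<and> b j" for j
    unfolding bit_horner_sum_bit_iff by auto
qed

section \<open>Polynomials of mean one with large partial sums at every point\<close>

definition first_diff :: "nat \<Rightarrow> nat \<Rightarrow> nat"
  where "first_diff i y = (LEAST j. bit i j \<noteq> bit y j)"

lemma first_diff_differs: "i \<noteq> y \<Longrightarrow> bit i (first_diff i y) \<noteq> bit y (first_diff i y)"
proof -
  assume "i \<noteq> y"
  then have "\<exists>j. bit i j \<noteq> bit y j" using bit_eqI[of i y] by blast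
  then show ?thesis unfolding first_diff_def by (rule LeastI_ex)
qed

lemma agree_below_first_diff: "j < first_diff i y \<Longrightarrow> bit i j = bit y j"
  unfolding first_diff_def by (drule not_less_Least) simp

lemma first_diff_less:
  assumes "i < 2 ^ n" and "y < 2 ^ n" and "i \<noteq> y"
  shows "first_diff i y < n"
proof -
  have "bit i (first_diff i y) \<or> bit y (first_diff i y)"
    using first_diff_differs[OF assms(3)] by blast
  then have "2 ^ first_diff i y \<le> i \<or> 2 ^ first_diff i y \<le> y"
    using bit_imp_power_le by blast
  then have "(2::nat) ^ first_diff i y < 2 ^ n"
    using assms(1,2) by linarith
  then show ?thesis by simp
qed

lemma first_diff_parity: "odd i \<noteq> odd y \<Longrightarrow> first_diff i y = 0"
  unfolding first_diff_def by (rule Least_eq_0) (simp add: bit_0)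

lemma first_diff_Suc:
  assumes "odd i = odd y" and "i \<noteq> y"
  shows "first_diff i y = Suc (first_diff (i div 2) (y div 2))"
proof -
  have "bit i (first_diff i y) \<noteq> bit y (first_diff i y)"
    using assms(2) by (rule first_diff_differs)
  moreover have "\<not> bit i 0 \<noteq> bit y 0" using assms(1) by (simp add: bit_0)
  ultimately have "(LEAST j. bit i j \<noteq> bit y j) = Suc (LEAST j. bit i (Suc j) \<noteq> bit y (Suc j))"
    by (rule Least_Suc[of "\<lambda>j. bit i j \<noteq> bit y j" "first_diff i y"])
  then show ?thesis unfolding first_diff_def bit_Suc .
qed

lemma sum_lessThan_double: "(\<Sum>i<2 * m. f i) = (\<Sum>i<m. f (2 * i) + f (2 * i + 1))"
  for f :: "nat \<Rightarrow> 'a::comm_monoid_add"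
  by (induction m) (simp_all add: add.assoc)

text \<open>
  Exactly 2^(n - 1 - s) of the numbers below 2^n differ from y for the first time at bit s, so each of the
  n values of s contributes 2^(n - 1). This is where the growth with n comes from. The
  induction on n pairs the numbers 2 i and 2 i + 1: one of them differs from y at bit 0, the other
  one behaves like i against y div 2.
\<close>

lemma sum_power_first_diff:
  assumes "y < 2 ^ n"
  shows "2 * (\<Sum>i<2 ^ n. if i = y then 0 else 2 ^ first_diff i y) = n * (2::nat) ^ n"
  using assms
proof (induction n arbitrary: y)
  case (Suc n)
  define z where "z = y div 2"
  have z: "z < 2 ^ n" using Suc.prems by (simp add: z_def)
  let ?g = "\<lambda>i y. if i = y then 0 else 2 ^ first_diff i y :: nat"
  have pair: "?g (2 * i) y + ?g (2 * i + 1) y = 1 + 2 * ?g i z" for i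
  proof (cases "odd y")
    case True
    then have y: "y = 2 * z + 1" by (simp add: z_def)
    show ?thesis
      using first_diff_Suc[of "2 * i + 1" y] first_diff_parity[of "2 * i" y] True y by auto
  next
    case False
    then have y: "y = 2 * z" by (simp add: z_def)
    show ?thesis
      using first_diff_Suc[of "2 * i" y] first_diff_parity[of "2 * i + 1" y] False y by auto
  qed
  have "(\<Sum>i<2 ^ Suc n. ?g i y) = (\<Sum>i<2 ^ n. 1 + 2 * ?g i z)"
    by (simp only: power_Suc sum_lessThan_double pair)
  also have "\<dots> = 2 ^ n + 2 * (\<Sum>i<2 ^ n. ?g i z)"
    by (simp only: sum.distrib sum_distrib_left) simp
  finally show ?case using Suc.IH[OF z] by simp
qed simp

text \<open>
  The Rademacher signs of the i-th atom, for i < 2^n. The first n digits are those of i, so that every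
  dyadic interval of length 2^(-n) contains one atom. Above them, the two digits at positions
  n + 2 i and n + 2 i + 1 are 1 for the i-th atom only; two of them are needed for the atom that
  lies in the same interval as the point of evaluation.
\<close>

definition atom_sign :: "nat \<Rightarrow> nat \<Rightarrow> nat \<Rightarrow> real"
  where "atom_sign n i j = (if (if j < n then bit i j else (j - n) div 2 = i) then - 1 else 1)"

lemma abs_atom_sign [simp]: "\<bar>atom_sign n i j\<bar> = 1"
  by (simp add: atom_sign_def)

text \<open>
  The high bits of p that belong to other atoms do not act on this one, because its digits
  vanish there.
\<close>

lemma sign_walsh_atom_sign:
  assumes v: "\<And>j. bit v j \<longleftrightarrow> j < n \<and> bit p j"
  shows "sign_walsh (atom_sign n i) p = sign_walsh (atom_sign n i) v
    * (if bit p (n + 2 * i) then - 1 else 1) * (if bit p (n + 2 * i + 1) then - 1 else 1)"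
proof -
  let ?H = "{j. n \<le> j \<and> bit p j}"
  have fin: "finite ?H" by (rule finite_subset[OF _ finite_bits[of p]]) auto
  have split: "{j. bit p j} = {j. bit v j} \<union> ?H" unfolding v by auto
  have "sign_walsh (atom_sign n i) p = sign_walsh (atom_sign n i) v * prod (atom_sign n i) ?H"
    unfolding sign_walsh_def split
    by (rule prod.union_disjoint[OF finite_bits fin]) (unfold v, auto)
  also have "prod (atom_sign n i) ?H = prod (atom_sign n i) (?H \<inter> {n + 2 * i, n + 2 * i + 1})"
  proof (rule prod.mono_neutral_right)
    show "\<forall>j\<in>?H - ?H \<inter> {n + 2 * i, n + 2 * i + 1}. atom_sign n i j = 1"
    proof
      fix j assume j: "j \<in> ?H - ?H \<inter> {n + 2 * i, n + 2 * i + 1}"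
      then have "n \<le> j" "j \<noteq> n + 2 * i" "j \<noteq> n + 2 * i + 1" by blast+
      then have "(j - n) div 2 \<noteq> i" by presburger
      with \<open>n \<le> j\<close> show "atom_sign n i j = 1" by (simp add: atom_sign_def)
    qed
  qed (use fin in auto)
  also have "\<dots> = (if bit p (n + 2 * i) then - 1 else 1) * (if bit p (n + 2 * i + 1) then - 1 else 1)"
  proof -
    have "atom_sign n i (n + 2 * i) = - 1" "atom_sign n i (n + 2 * i + 1) = - 1"
      by (simp_all add: atom_sign_def)
    moreover have "n \<le> n + 2 * i" "n \<le> n + 2 * i + 1" "n + 2 * i \<noteq> n + 2 * i + 1" by simp_all
    ultimately show ?thesis
      by (cases "bit p (n + 2 * i)"; cases "bit p (n + 2 * i + 1)")
        (simp_all add: Int_insert_right del: One_nat_def add_Suc_right)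
  qed
  finally show ?thesis by (simp only: mult.assoc)
qed

lemma signed_take_bit_cong:
  assumes "\<And>j. j \<le> s \<Longrightarrow> bit p j = bit v j"
  shows "signed_take_bit s (int p) = signed_take_bit s (int v)"
  unfolding signed_take_bit_eq_iff_take_bit_eq
  by (rule bit_eqI) (use assms in \<open>auto simp: bit_take_bit_iff bit_of_nat_iff_bit\<close>)

text \<open>
  For a point with signs \<open>\<rho>\<close>, let y be the index of the atom that shares its first n digits. The low
  bits of p alternate, which makes the kernels of all other atoms large. Up to the
  common factor W_p(\<open>\<rho>\<close>), the private bits of p make all these terms nonnegative, and they add up to at
  least n 2^n / 4. The term of the atom y has no known size. But switching one of its private bits in p
  reverses the sign of its term and preserves the signs of all others, so for one of
  the two choices it does not reduce the sum.
\<close>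

lemma large_kernel_sum:
  fixes \<rho> :: "nat \<Rightarrow> real"
  assumes sign: "\<And>j. \<rho> j = 1 \<or> \<rho> j = - 1"
  shows "\<exists>p\<le>2 ^ (n + 2 * 2 ^ n).
    real n * 2 ^ n \<le> 4 * \<bar>\<Sum>i<2 ^ n. dirichlet (\<lambda>j. \<rho> j * atom_sign n i j) p\<bar>"
proof -
  define R where "R = n + 2 * 2 ^ n"
  obtain y :: nat where y: "y < 2 ^ n" and bit_y: "\<And>j. bit y j \<longleftrightarrow> j < n \<and> \<rho> j = - 1"
    using exists_with_bits[of n "\<lambda>j. \<rho> j = - 1"] by blast
  obtain v :: nat where bit_v: "\<And>j. bit v j \<longleftrightarrow> j < n \<and> even j"
    using exists_with_bits[of n even] by blast
  define u where "u = (\<lambda>i j. \<rho> j * atom_sign n i j)"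
  define K where "K = (\<lambda>s p. real_of_int (signed_take_bit s (int p)))"
  define bad where "bad = (\<lambda>i. sign_walsh (atom_sign n i) v * K (first_diff i y) v < 0)"
  have u_y: "u y j = 1" if "j < n" for j
    using that bit_y[of j] sign[of j] by (auto simp: u_def atom_sign_def)

  \<comment> \<open>the first sign change between the point and its own atom; all frequencies used are below
    2^R, so that R may stand for a change that does not occur\<close>
  define s where "s = (LEAST j. u y j = - 1 \<or> j = R)"
  have s: "u y s = - 1 \<or> s = R"
    unfolding s_def by (rule LeastI[of _ R]) simp
  have below_s: "u y j = 1" if "j < s" for j
    using not_less_Least[OF that[unfolded s_def]] sign[of j] by (auto simp: u_def atom_sign_def split: if_splits)
  have "n \<le> s"
  proof (rule ccontr)
    assume "\<not> n \<le> s"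
    then have "u y s = 1" "s \<noteq> R" by (auto simp: u_y R_def)
    with s show False by simp
  qed

  \<comment> \<open>of the two private bits of the atom y, one that differs from the sign change s: switching it
    keeps bit s of p, on which the sign of the kernel value of this atom depends\<close>
  obtain q where q: "q \<in> {2 * y, 2 * y + 1}" "n + q \<noteq> s"
    by (cases "s = n + 2 * y") auto
  \<comment> \<open>for each other atom, the private bit that corrects a negative term is set\<close>
  define b where "b = (\<lambda>j. j < n \<and> even j \<or> (\<exists>i<2 ^ n. i \<noteq> y \<and> bad i \<and> j = n + 2 * i))"
  from exists_with_bits[of R b] obtain p0 :: nat
    where "p0 < 2 ^ R \<and> (\<forall>j. bit p0 j \<longleftrightarrow> j < R \<and> b j)" ..
  then have p0: "p0 < 2 ^ R" "\<And>j. bit p0 j \<longleftrightarrow> j < R \<and> b j" by simp_all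
  from exists_with_bits[of R "\<lambda>j. b j \<or> j = n + q"] obtain p1 :: nat
    where "p1 < 2 ^ R \<and> (\<forall>j. bit p1 j \<longleftrightarrow> j < R \<and> (b j \<or> j = n + q))" ..
  then have p1: "p1 < 2 ^ R" "\<And>j. bit p1 j \<longleftrightarrow> j < R \<and> (b j \<or> j = n + q)" by simp_all

  have "n \<le> R" by (simp add: R_def)
  have b_low: "b j \<longleftrightarrow> even j" if "j < n" for j
    using that unfolding b_def by auto
  have p0_low: "bit p0 j \<longleftrightarrow> bit v j" and p1_low: "bit p1 j \<longleftrightarrow> bit v j" if "j < n" for j
    using that \<open>n \<le> R\<close> unfolding p0(2) p1(2) bit_v by (auto simp: b_low)

  have other: "dirichlet (u i) p = sign_walsh \<rho> p * \<bar>K (first_diff i y) v\<bar>"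
    if i: "i < 2 ^ n" "i \<noteq> y" and p: "p = p0 \<or> p = p1" for i p
  proof -
    let ?d = "first_diff i y"
    have bits: "bit p j \<longleftrightarrow> bit v j" if "j < n" for j
      using p p0_low[OF that] p1_low[OF that] by blast
    have "bit i ?d \<noteq> bit y ?d" by (rule first_diff_differs) (rule i)
    have "?d < n"
      using i(1) y i(2) by (rule first_diff_less)
    have "u i j = 1" if "j < ?d" for j
      using u_y[of j] agree_below_first_diff[OF that] that \<open>?d < n\<close> by (simp add: u_def atom_sign_def)
    moreover have "u i ?d = - 1"
      using u_y[of ?d] \<open>bit i ?d \<noteq> bit y ?d\<close> \<open>?d < n\<close> by (auto simp: u_def atom_sign_def split: if_splits)
    ultimately have "dirichlet (u i) p = sign_walsh (u i) p * K ?d p"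
      unfolding K_def by (intro dirichlet_first_change) auto
    moreover have "K ?d p = K ?d v"
      unfolding K_def using bits \<open>?d < n\<close> by (subst signed_take_bit_cong[of _ p v]) auto
    moreover have "sign_walsh (u i) p = sign_walsh \<rho> p * sign_walsh (atom_sign n i) p"
      unfolding u_def by (rule sign_walsh_mult)
    moreover have "sign_walsh (atom_sign n i) p = sign_walsh (atom_sign n i) v * (if bad i then - 1 else 1)"
    proof -
      have "n + 2 * i < R" "n + 2 * i + 1 < R" using i by (auto simp: R_def)
      moreover have "n + 2 * i + 1 \<noteq> n + 2 * k" for k by presburger
      moreover have "n + 2 * i \<noteq> n + q" "n + 2 * i + 1 \<noteq> n + q"
        using i q(1) by simp_all presburger+
      ultimately have "bit p (n + 2 * i) \<longleftrightarrow> bad i" "\<not> bit p (n + 2 * i + 1)"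
        using p p0(2) p1(2) i by (auto simp: b_def)
      moreover have "sign_walsh (atom_sign n i) p = sign_walsh (atom_sign n i) v
        * (if bit p (n + 2 * i) then - 1 else 1) * (if bit p (n + 2 * i + 1) then - 1 else 1)"
      proof (rule sign_walsh_atom_sign)
        show "bit v j \<longleftrightarrow> j < n \<and> bit p j" for j
          using bits[of j] bit_v[of j] by (cases "j < n") simp_all
      qed
      ultimately show ?thesis by simp
    qed
    moreover have "\<bar>sign_walsh (atom_sign n i) v\<bar> = 1" by (rule sign_walsh_abs) simp
    then have "sign_walsh (atom_sign n i) v * (if bad i then - 1 else 1) * K ?d v = \<bar>K ?d v\<bar>"
      by (auto simp: bad_def abs_if split: if_splits)
    ultimately show ?thesis by (simp add: mult.assoc)
  qed

  define T where "T = (\<lambda>p. sign_walsh (atom_sign n y) p * K s p)"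
  define B where "B = (\<Sum>i<2 ^ n. if i = y then 0 else \<bar>K (first_diff i y) v\<bar>)"
  have total: "(\<Sum>i<2 ^ n. dirichlet (u i) p) = sign_walsh \<rho> p * (B + T p)" if p: "p = p0 \<or> p = p1" for p
  proof -
    have own: "dirichlet (u y) p = sign_walsh \<rho> p * T p"
    proof -
      have "p < 2 ^ R" using p p0(1) p1(1) by auto
      then have "dirichlet (u y) p = sign_walsh (u y) p * K s p"
        unfolding K_def using s below_s by (intro dirichlet_first_change) auto
      then show ?thesis by (simp add: u_def sign_walsh_mult T_def)
    qed
    have "(\<Sum>i<2 ^ n. dirichlet (u i) p)
      = (\<Sum>i<2 ^ n. sign_walsh \<rho> p * (if i = y then 0 else \<bar>K (first_diff i y) v\<bar>)
          + (if i = y then sign_walsh \<rho> p * T p else 0))"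
      by (rule sum.cong) (use own other p in auto)
    also have "\<dots> = sign_walsh \<rho> p * (B + T p)"
      using y by (simp add: sum.distrib B_def distrib_left flip: sum_distrib_left)
    finally show ?thesis .
  qed

  have "0 \<le> T p0 \<or> 0 \<le> T p1"
  proof -
    \<comment> \<open>the sign of the two's complement value is decided by bit s alone\<close>
    have "bit p0 s = bit p1 s" using p0(2) p1(2) q(2) by auto
    then have same: "0 \<le> K s p0 \<longleftrightarrow> 0 \<le> K s p1"
      by (simp add: K_def bit_of_nat_iff_bit signed_take_bit_nonnegative_iff)
    have R: "n + 2 * y < R" "n + 2 * y + 1 < R" using y by (auto simp: R_def)
    have even: "n + 2 * y + 1 \<noteq> n + 2 * k" for k by presburger
    have low: "bit v j \<longleftrightarrow> j < n \<and> bit p0 j" "bit v j \<longleftrightarrow> j < n \<and> bit p1 j" for j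
      using p0_low[of j] p1_low[of j] bit_v[of j] by blast+
    have nb: "\<not> b (n + 2 * y)" "\<not> b (n + 2 * y + 1)"
      using even by (auto simp: b_def)
    have "sign_walsh (atom_sign n y) p0 = sign_walsh (atom_sign n y) v"
      using nb by (simp add: sign_walsh_atom_sign[of v n p0, OF low(1)] p0(2) del: One_nat_def)
    moreover have "sign_walsh (atom_sign n y) p1 = - sign_walsh (atom_sign n y) v"
      using nb q(1) R by (auto simp: sign_walsh_atom_sign[of v n p1, OF low(2)] p1(2) simp del: One_nat_def)
    moreover have "\<bar>sign_walsh (atom_sign n y) v\<bar> = 1" by (rule sign_walsh_abs) simp
    ultimately show ?thesis using same unfolding T_def by (auto simp: abs_if split: if_splits)
  qed
  then obtain p where p: "p = p0 \<or> p = p1" and T: "0 \<le> T p" by blast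
  have B: "real n * 2 ^ n \<le> 4 * B"
  proof -
    have K: "2 ^ first_diff i y \<le> 2 * \<bar>K (first_diff i y) v\<bar>" if "i < 2 ^ n" "i \<noteq> y" for i
    proof -
      let ?d = "first_diff i y"
      have "?d < n" using that(1) y that(2) by (rule first_diff_less)
      then have "case ?d of 0 \<Rightarrow> bit v 0 | Suc r \<Rightarrow> bit v ?d \<noteq> bit v r"
        using bit_v by (auto split: nat.split)
      then have "2 ^ ?d \<le> 2 * \<bar>signed_take_bit ?d (int v)\<bar>"
        by (rule signed_take_bit_large)
      then have "real_of_int (2 ^ ?d) \<le> real_of_int (2 * \<bar>signed_take_bit ?d (int v)\<bar>)"
        by (rule of_int_le_iff[THEN iffD2])
      then show ?thesis by (simp add: K_def)
    qed
    have "real n * 2 ^ n = real (2 * (\<Sum>i<2 ^ n. if i = y then 0 else 2 ^ first_diff i y))"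
      unfolding sum_power_first_diff[OF y] by simp
    also have "\<dots> = 2 * (\<Sum>i<2 ^ n. if i = y then 0 else 2 ^ first_diff i y)"
      by (simp add: of_nat_sum if_distrib[of real] cong: if_cong)
    also have "\<dots> \<le> 2 * (\<Sum>i<2 ^ n. 2 * (if i = y then 0 else \<bar>K (first_diff i y) v\<bar>))"
      using K by (intro mult_left_mono sum_mono) auto
    also have "\<dots> = 4 * B" unfolding B_def by (simp flip: sum_distrib_left)
    finally show ?thesis .
  qed
  have "0 \<le> B" unfolding B_def by (intro sum_nonneg) auto
  have "\<bar>sign_walsh \<rho> p\<bar> = 1" by (rule sign_walsh_abs) (use sign in \<open>metis abs_1 abs_minus_cancel\<close>)
  then have "\<bar>\<Sum>i<2 ^ n. dirichlet (u i) p\<bar> = B + T p"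
    using T \<open>0 \<le> B\<close> by (simp add: total[OF p] abs_mult)
  moreover have "p \<le> 2 ^ R" using p p0(1) p1(1) by auto
  ultimately show ?thesis using B T by (intro exI[of _ p]) (simp add: u_def R_def)
qed

text \<open>
  The coefficients A of a nonnegative Walsh polynomial of mean 1 such that at every point
  some partial sum is at least C in absolute value. Quantifying over all sign sequences instead of
  points of the unit interval lets the property pass to every dilate.
\<close>

definition spike :: "real \<Rightarrow> nat \<Rightarrow> (nat \<Rightarrow> real) \<Rightarrow> bool"
  where "spike C R A \<longleftrightarrow> A 0 = 1 \<and> (\<forall>k. \<bar>A k\<bar> \<le> 1) \<and>
    (\<forall>\<rho>. (\<forall>j. \<rho> j = 1 \<or> \<rho> j = - 1) \<longrightarrow>
      0 \<le> (\<Sum>k<2 ^ R. A k * sign_walsh \<rho> k) \<and> (\<exists>p\<le>2 ^ R. C \<le> \<bar>\<Sum>k<p. A k * sign_walsh \<rho> k\<bar>))"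

lemma spike_large:
  assumes "spike C R A" and "\<And>j. \<rho> j = 1 \<or> \<rho> j = - 1"
  shows "\<exists>p\<le>2 ^ R. C \<le> \<bar>\<Sum>k<p. A k * sign_walsh \<rho> k\<bar>"
  using assms by (simp add: spike_def)

text \<open>
  The polynomial is the average of the kernels D_(2^R) translated to the atoms, with R = n + 2 * 2^n large
  enough to cover all the digits used. These kernels are nonnegative of mean 1, and for p at most 2^R the
  p-th partial sum of a translated D_(2^R) is the translated D_p.
\<close>

lemma exists_spike: "\<exists>R A. spike C R A"
proof -
  obtain n :: nat where n: "4 * C \<le> real n" using real_arch_simple by blast
  define A where "A = (\<lambda>k. (\<Sum>i<2 ^ n. sign_walsh (atom_sign n i) k) / 2 ^ n)"
  have partial: "(\<Sum>k<p. A k * sign_walsh \<rho> k)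
    = (\<Sum>i<2 ^ n. dirichlet (\<lambda>j. \<rho> j * atom_sign n i j) p) / 2 ^ n" for p \<rho>
    unfolding A_def dirichlet_def sign_walsh_mult times_divide_eq_left sum_distrib_right
    by (subst sum.swap) (simp add: mult.commute flip: sum_divide_distrib)
  have "A 0 = 1" by (simp add: A_def)
  moreover have "\<bar>A k\<bar> \<le> 1" for k
  proof -
    have "\<bar>\<Sum>i<2 ^ n. sign_walsh (atom_sign n i) k\<bar> \<le> (\<Sum>i<2 ^ n. \<bar>sign_walsh (atom_sign n i) k\<bar>)"
      by (rule sum_abs)
    also have "\<dots> = 2 ^ n" by (simp add: sign_walsh_abs)
    finally show ?thesis by (simp add: A_def)
  qed
  moreover have "0 \<le> (\<Sum>k<2 ^ (n + 2 * 2 ^ n). A k * sign_walsh \<rho> k)"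
    and "\<exists>p\<le>2 ^ (n + 2 * 2 ^ n). C \<le> \<bar>\<Sum>k<p. A k * sign_walsh \<rho> k\<bar>"
    if sign: "\<And>j. \<rho> j = 1 \<or> \<rho> j = - 1" for \<rho>
  proof -
    have "\<bar>\<rho> j * atom_sign n i j\<bar> = 1" for i j using sign[of j] by (auto simp: abs_mult)
    then show "0 \<le> (\<Sum>k<2 ^ (n + 2 * 2 ^ n). A k * sign_walsh \<rho> k)"
      unfolding partial by (intro divide_nonneg_pos sum_nonneg dirichlet_power_nonneg) auto
    obtain p where p: "p \<le> 2 ^ (n + 2 * 2 ^ n)"
      "real n * 2 ^ n \<le> 4 * \<bar>\<Sum>i<2 ^ n. dirichlet (\<lambda>j. \<rho> j * atom_sign n i j) p\<bar>"
      using large_kernel_sum[of \<rho> n, OF sign] by blast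
    have "4 * C * 2 ^ n \<le> real n * 2 ^ n" using n by (intro mult_right_mono) auto
    with p(2) have "C * 2 ^ n \<le> \<bar>\<Sum>i<2 ^ n. dirichlet (\<lambda>j. \<rho> j * atom_sign n i j) p\<bar>"
      by linarith
    then have "C \<le> \<bar>\<Sum>k<p. A k * sign_walsh \<rho> k\<bar>"
      unfolding partial by (simp add: pos_le_divide_eq)
    with p(1) show "\<exists>p\<le>2 ^ (n + 2 * 2 ^ n). C \<le> \<bar>\<Sum>k<p. A k * sign_walsh \<rho> k\<bar>" by blast
  qed
  ultimately have "spike C (n + 2 * 2 ^ n) A" unfolding spike_def by simp
  then show ?thesis by (intro exI)
qed

section \<open>Walsh functions on the unit interval\<close>

lemma walsh_eq_sign_walsh: "walsh k x = sign_walsh (\<lambda>j. rademacher j x) k"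
  by (simp add: walsh_def sign_walsh_def)

lemma rademacher_cases: "rademacher k x = 1 \<or> rademacher k x = - 1"
  using digit_range[of k x] by (auto simp: rademacher_def)

lemma abs_rademacher: "\<bar>rademacher k x\<bar> = 1"
  by (simp add: rademacher_def power_abs)

lemma abs_walsh [simp]: "\<bar>walsh k x\<bar> = 1"
  unfolding walsh_eq_sign_walsh by (rule sign_walsh_abs) (rule abs_rademacher)

lemma rademacher_Suc: "rademacher (Suc k) x = rademacher k (2 * x)"
  by (simp add: rademacher_def digit_def mult_ac)

lemma rademacher_periodic: "rademacher k (x + 1) = rademacher k x"
proof -
  have "2 ^ (k + 1) * (x + 1) = 2 ^ (k + 1) * x + of_int (2 * 2 ^ k)"
    by (simp add: algebra_simps)
  then have "\<lfloor>2 ^ (k + 1) * (x + 1)\<rfloor> = \<lfloor>2 ^ (k + 1) * x\<rfloor> + 2 * 2 ^ k"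
    by (simp only: floor_add_int[symmetric])
  then show ?thesis by (simp add: rademacher_def digit_def)
qed

lemma walsh_rec: "walsh k x = (if odd k then rademacher 0 x else 1) * walsh (k div 2) (2 * x)"
  unfolding walsh_eq_sign_walsh by (subst sign_walsh_rec) (simp add: rademacher_Suc)

lemma walsh_periodic: "walsh k (1 + x) = walsh k x"
  by (simp add: walsh_eq_sign_walsh rademacher_periodic add.commute[of 1])

lemma rademacher_0: "0 \<le> x \<Longrightarrow> x < 1 / 2 \<Longrightarrow> rademacher 0 x = 1"
  "1 / 2 \<le> x \<Longrightarrow> x < 1 \<Longrightarrow> rademacher 0 x = - 1"
proof -
  show "rademacher 0 x = 1" if "0 \<le> x" "x < 1 / 2"
  proof -
    have "\<lfloor>2 * x\<rfloor> = 0" using that by (simp add: floor_eq_iff)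
    then show ?thesis by (simp add: rademacher_def digit_def)
  qed
  show "rademacher 0 x = - 1" if "1 / 2 \<le> x" "x < 1"
  proof -
    have "\<lfloor>2 * x\<rfloor> = 1" using that by (simp add: floor_eq_iff)
    then show ?thesis by (simp add: rademacher_def digit_def)
  qed
qed

lemma measurable_walsh [measurable]: "walsh k \<in> borel_measurable borel"
  unfolding walsh_def rademacher_def digit_def by measurable

lemma integrable_interval_bounded:
  fixes f :: "real \<Rightarrow> real"
  assumes [measurable]: "f \<in> borel_measurable borel" and "\<And>x. \<bar>f x\<bar> = 1"
  shows "integrable lborel (\<lambda>x. indicator {a..<b} x * f x)"
proof (rule Bochner_Integration.integrable_bound)
  show "integrable lborel (indicator {a..<b} :: real \<Rightarrow> real)"
    by (cases "a \<le> b") (auto intro!: integrable_real_indicator)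
qed (auto simp: abs_mult assms(2))

text \<open>
  By periodicity, both halves of the unit interval carry the same compressed copy of the Walsh function of
  index k div 2, with opposite signs if k is odd. So the halves cancel for odd k, and
  reproduce the integral for k div 2 if k is even.
\<close>

lemma integral_walsh: "(\<integral>x. indicator {0..<1} x * walsh k x \<partial>lborel) = of_bool (k = 0)"
proof (induction k rule: less_induct)
  case (less k)
  define I where "I = (\<lambda>k. \<integral>x. indicator {0..<1} x * walsh k x \<partial>lborel)"
  show ?case
  proof (cases "k = 0")
    case True
    then show ?thesis by (simp add: walsh_def)
  next
    case False
    let ?m = "k div 2" and ?\<sigma> = "if odd k then - 1 else 1 :: real"
    let ?l = "\<lambda>x. indicator {0..<1/2} x * walsh ?m (2 * x) :: real"
      and ?r = "\<lambda>x. indicator {1/2..<1} x * walsh ?m (2 * x) :: real"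
    have int: "integrable lborel (\<lambda>x. indicator {a..<b} x * walsh ?m (2 * x))" for a b
      by (rule integrable_interval_bounded)
        (auto intro!: measurable_compose[OF _ measurable_walsh])
    have "indicator {0..<1} x * walsh k x = ?l x + ?\<sigma> * ?r x" for x :: real
      unfolding walsh_rec[of k x] using rademacher_0[of x]
      by (auto simp: indicator_def not_less)
    then have "I k = (\<integral>x. ?l x \<partial>lborel) + ?\<sigma> * (\<integral>x. ?r x \<partial>lborel)"
      unfolding I_def using int by simp
    also have "(\<integral>x. ?l x \<partial>lborel) = I ?m / 2"
    proof -
      have "?l (0 + 1 / 2 * x) = indicator {0..<1} x * walsh ?m x" for x
        by (auto simp: indicator_def)
      moreover have "(\<integral>x. ?l x \<partial>lborel) = \<bar>1 / 2\<bar> *\<^sub>R (\<integral>x. ?l (0 + 1 / 2 * x) \<partial>lborel)"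
        by (rule lborel_integral_real_affine) simp
      ultimately show ?thesis by (simp only: I_def) simp
    qed
    also have "(\<integral>x. ?r x \<partial>lborel) = I ?m / 2"
    proof -
      have "?r (1 / 2 + 1 / 2 * x) = indicator {0..<1} x * walsh ?m x" for x
      proof -
        have "2 * (1 / 2 + 1 / 2 * x) = 1 + x" by simp
        then show ?thesis by (simp only: walsh_periodic) (auto simp: indicator_def)
      qed
      moreover have "(\<integral>x. ?r x \<partial>lborel) = \<bar>1 / 2\<bar> *\<^sub>R (\<integral>x. ?r (1 / 2 + 1 / 2 * x) \<partial>lborel)"
        by (rule lborel_integral_real_affine) simp
      ultimately show ?thesis by (simp only: I_def) simp
    qed
    finally have "I k = (if odd k then 0 else I ?m)" by simp
    moreover have "I ?m = of_bool (?m = 0)"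
      unfolding I_def by (rule less.IH) (use False in simp)
    moreover have "?m \<noteq> 0" if "even k" using that False by auto
    ultimately show ?thesis using False by (simp add: I_def)
  qed
qed

lemma walsh_orthonormal:
  "(\<integral>x. indicator {0..<1} x * (walsh k x * walsh l x) \<partial>lborel) = of_bool (k = l)"
proof -
  have "walsh k x * walsh l x = walsh (semiring_bit_operations_class.xor k l) x" for x
    unfolding walsh_eq_sign_walsh by (rule sign_walsh_xor) (use rademacher_cases[of _ x] in \<open>metis mult_1 square_eq_1_iff\<close>)
  moreover have "semiring_bit_operations_class.xor k l = 0 \<longleftrightarrow> k = l"
    by (auto simp: bit_eq_iff bit_xor_iff)
  ultimately show ?thesis by (simp only: integral_walsh)
qed

text \<open>
  For nonnegative functions with summable integrals, monotone convergence gives pointwise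
  summability almost everywhere, and then dominated convergence applies after multiplication by a bounded
  function. At the exceptional points the infinite sum has an arbitrary value.
\<close>

lemma sums_integral_nonneg:
  fixes g :: "nat \<Rightarrow> 'a \<Rightarrow> real"
  assumes g: "\<And>j. integrable M (g j)" and nonneg: "\<And>j x. 0 \<le> g j x"
    and sum: "summable (\<lambda>j. \<integral>x. g j x \<partial>M)"
    and h: "h \<in> borel_measurable M" "\<And>x. \<bar>h x\<bar> \<le> 1"
  shows "integrable M (\<lambda>x. (\<Sum>j. g j x) * h x)"
    and "(\<lambda>j. \<integral>x. g j x * h x \<partial>M) sums (\<integral>x. (\<Sum>j. g j x) * h x \<partial>M)"
proof -
  have [measurable]: "g j \<in> borel_measurable M" for j
    using g by (rule borel_measurable_integrable)
  note [measurable] = h(1)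
  have "(\<integral>\<^sup>+x. (\<Sum>j. ennreal (g j x)) \<partial>M) = (\<Sum>j. ennreal (\<integral>x. g j x \<partial>M))"
    using g nonneg by (simp add: nn_integral_suminf nn_integral_eq_integral)
  also have "\<dots> = ennreal (\<Sum>j. \<integral>x. g j x \<partial>M)"
    using sum nonneg by (intro suminf_ennreal2 integral_nonneg) auto
  finally have "AE x in M. (\<Sum>j. ennreal (g j x)) \<noteq> \<infinity>"
    by (intro nn_integral_PInf_AE) auto
  then have AE: "AE x in M. summable (\<lambda>j. g j x)"
    by eventually_elim (use nonneg in \<open>auto intro: summable_suminf_not_top\<close>)
  have gh_le: "\<bar>g j x * h x\<bar> \<le> g j x" for j x
    using nonneg[of j x] h(2)[of x] by (simp add: abs_mult mult_left_le)
  have gh: "integrable M (\<lambda>x. g j x * h x)" for j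
    by (rule Bochner_Integration.integrable_bound[OF g[of j]]) (use gh_le nonneg in auto)
  have AE_gh: "AE x in M. summable (\<lambda>j. norm (g j x * h x))"
    using AE by eventually_elim (rule summable_comparison_test', assumption, use gh_le in simp)
  have sum_gh: "summable (\<lambda>j. \<integral>x. norm (g j x * h x) \<partial>M)"
  proof (rule summable_comparison_test'[OF sum])
    fix j
    have "(\<integral>x. norm (g j x * h x) \<partial>M) \<le> (\<integral>x. g j x \<partial>M)"
      by (rule integral_mono) (use gh g gh_le in auto)
    then show "norm (\<integral>x. norm (g j x * h x) \<partial>M) \<le> (\<integral>x. g j x \<partial>M)"
      by (simp add: integral_nonneg)
  qed
  have eq: "AE x in M. (\<Sum>j. g j x * h x) = (\<Sum>j. g j x) * h x"
    using AE by eventually_elim (rule suminf_mult2[symmetric])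
  have int: "integrable M (\<lambda>x. \<Sum>j. g j x * h x)"
    by (rule integrable_suminf[OF gh AE_gh sum_gh])
  show "integrable M (\<lambda>x. (\<Sum>j. g j x) * h x)"
    by (rule integrable_cong_AE_imp[OF int _ eq]) measurable
  have "(\<integral>x. (\<Sum>j. g j x * h x) \<partial>M) = (\<integral>x. (\<Sum>j. g j x) * h x \<partial>M)"
    by (rule integral_cong_AE) (use eq in auto)
  then show "(\<lambda>j. \<integral>x. g j x * h x \<partial>M) sums (\<integral>x. (\<Sum>j. g j x) * h x \<partial>M)"
    using sums_integral[OF gh AE_gh sum_gh] by simp
qed

lemma set_integrable_lebesgue_iff:
  fixes f :: "real \<Rightarrow> real"
  assumes "f \<in> borel_measurable borel"
  shows "set_integrable lebesgue {0..<1} f \<longleftrightarrow> integrable lborel (\<lambda>x. indicator {0..<1} x * f x)"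
  unfolding set_integrable_def real_scaleR_def
  by (rule integrable_completion) (use assms in measurable)

lemma walsh_coeff_lborel:
  assumes "f \<in> borel_measurable borel"
  shows "walsh_coeff f k = (\<integral>x. indicator {0..<1} x * (f x * walsh k x) \<partial>lborel)"
  unfolding walsh_coeff_def set_lebesgue_integral_def real_scaleR_def
  by (rule integral_completion) (use assms in measurable)

section \<open>Dilated polynomials\<close>

definition dilated_block :: "nat \<Rightarrow> (nat \<Rightarrow> real) \<Rightarrow> nat \<Rightarrow> real \<Rightarrow> real"
  where "dilated_block R A M x = (\<Sum>k<2 ^ R. A k * walsh (2 ^ M * k) x)"

lemma measurable_dilated_block [measurable]: "dilated_block R A M \<in> borel_measurable borel"
  unfolding dilated_block_def by measurable

lemma walsh_coeff_dilated_block: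
  "walsh_coeff (dilated_block R A M) m = (\<Sum>k<2 ^ R. A k * of_bool (2 ^ M * k = m))"
proof -
  have int: "integrable lborel (\<lambda>x. indicator {0..<1} x * (walsh k x * walsh m x))" for k
    by (rule integrable_interval_bounded) (auto simp: abs_mult intro!: borel_measurable_times)
  have "walsh_coeff (dilated_block R A M) m
    = (\<integral>x. (\<Sum>k<2 ^ R. A k * (indicator {0..<1} x * (walsh (2 ^ M * k) x * walsh m x))) \<partial>lborel)"
    unfolding walsh_coeff_lborel[OF measurable_dilated_block] dilated_block_def
    by (simp add: sum_distrib_left sum_distrib_right mult_ac)
  also have "\<dots> = (\<Sum>k<2 ^ R. A k * of_bool (2 ^ M * k = m))"
    using int by (subst Bochner_Integration.integral_sum) (simp_all add: walsh_orthonormal)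
  finally show ?thesis .
qed

lemma walsh_sum_dilated_block:
  "walsh_sum q (dilated_block R A M) x
    = (\<Sum>k | k < 2 ^ R \<and> 2 ^ M * k < q. A k * walsh (2 ^ M * k) x)"
proof -
  have "walsh_sum q (dilated_block R A M) x
    = (\<Sum>k<2 ^ R. \<Sum>m<q. A k * of_bool (2 ^ M * k = m) * walsh m x)"
    unfolding walsh_sum_def walsh_coeff_dilated_block sum_distrib_right by (rule sum.swap)
  also have "\<dots> = (\<Sum>k<2 ^ R. if 2 ^ M * k < q then A k * walsh (2 ^ M * k) x else 0)"
  proof (rule sum.cong)
    fix k
    have "(\<Sum>m<q. A k * of_bool (2 ^ M * k = m) * walsh m x)
      = (\<Sum>m<q. if 2 ^ M * k = m then A k * walsh m x else 0)"
      by (rule sum.cong) auto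
    then show "(\<Sum>m<q. A k * of_bool (2 ^ M * k = m) * walsh m x)
      = (if 2 ^ M * k < q then A k * walsh (2 ^ M * k) x else 0)" by simp
  qed simp
  also have "\<dots> = (\<Sum>k | k < 2 ^ R \<and> 2 ^ M * k < q. A k * walsh (2 ^ M * k) x)"
    by (subst sum.inter_filter[symmetric]) (auto intro!: sum.cong)
  finally show ?thesis .
qed

lemma abs_walsh_sum_dilated_block:
  assumes "\<And>k. \<bar>A k\<bar> \<le> 1"
  shows "\<bar>walsh_sum q (dilated_block R A M) x\<bar> \<le> 2 ^ R"
proof -
  have "\<bar>walsh_sum q (dilated_block R A M) x\<bar>
    \<le> (\<Sum>k | k < 2 ^ R \<and> 2 ^ M * k < q. \<bar>A k * walsh (2 ^ M * k) x\<bar>)"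
    unfolding walsh_sum_dilated_block by (rule sum_abs)
  also have "\<dots> \<le> (\<Sum>k | k < 2 ^ R \<and> 2 ^ M * k < q. 1)"
    by (rule sum_mono) (simp add: abs_mult assms)
  also have "\<dots> = real (card {k. k < 2 ^ R \<and> 2 ^ M * k < q})" by simp
  also have "\<dots> \<le> real (card {..<2 ^ R :: nat})"
    by (intro of_nat_mono card_mono) auto
  finally show ?thesis by simp
qed

lemma walsh_sum_dilated_block_low:
  assumes "A 0 = 1" and "1 \<le> q" and "q \<le> 2 ^ M"
  shows "walsh_sum q (dilated_block R A M) x = 1"
proof -
  have "\<not> 2 ^ M * k < q" if "k \<noteq> 0" for k
  proof -
    have "2 ^ M * 1 \<le> 2 ^ M * k" using that by (intro mult_le_mono2) linarith
    with assms(3) show ?thesis by linarith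
  qed
  moreover have "2 ^ M * 0 < q" using assms(2) by linarith
  moreover have "(0::nat) < 2 ^ R" by simp
  ultimately have "{k. k < 2 ^ R \<and> 2 ^ M * k < q} = {0}" by blast
  then have "walsh_sum q (dilated_block R A M) x = A 0 * walsh (2 ^ M * 0) x"
    unfolding walsh_sum_dilated_block by (simp only: sum.insert sum.empty finite.emptyI empty_iff not_False_eq_True add_0_right)
  then show ?thesis by (simp add: assms(1) walsh_def)
qed

text \<open>
  All frequencies are multiples of 2^M, so the partial sums are constant between consecutive multiples,
  with the value of the p-th partial sum of the undilated polynomial.
\<close>

lemma walsh_sum_dilated_block_plateau:
  assumes "2 ^ M * p < q + 2 ^ M" and "q \<le> 2 ^ M * p" and "p \<le> 2 ^ R"
  shows "walsh_sum q (dilated_block R A M) x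
    = (\<Sum>k<p. A k * sign_walsh (\<lambda>j. rademacher (M + j) x) k)"
proof -
  have "2 ^ M * k < q \<longleftrightarrow> k < p" for k
  proof
    assume "2 ^ M * k < q"
    then have "2 ^ M * k < 2 ^ M * p" using assms(2) by linarith
    then show "k < p" by simp
  next
    assume "k < p"
    then have "2 ^ M * Suc k \<le> 2 ^ M * p" by (intro mult_le_mono2) (rule Suc_leI)
    then have "2 ^ M * k + 2 ^ M \<le> 2 ^ M * p" by simp
    then show "2 ^ M * k < q" using assms(1) by linarith
  qed
  moreover have "k < p \<Longrightarrow> k < 2 ^ R" for k using assms(3) by linarith
  ultimately have "{k. k < 2 ^ R \<and> 2 ^ M * k < q} = {..<p}" by blast
  then show ?thesis
    unfolding walsh_sum_dilated_block walsh_eq_sign_walsh sign_walsh_shift by (simp only:)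
qed

section \<open>Concentration of the weights at the end of a row\<close>

lemma top_bit_bounds:
  assumes "n \<ge> 1"
  shows "2 ^ top_bit n \<le> n" and "n < 2 ^ Suc (top_bit n)"
proof -
  have "n \<noteq> 0" using assms by simp
  then have ne: "{s. bit n s} \<noteq> {}" by (auto simp: bit_eq_iff)
  have "top_bit n \<in> {s. bit n s}"
    unfolding top_bit_def by (rule Max_in[OF finite_bits ne])
  then show "2 ^ top_bit n \<le> n" by (simp add: bit_imp_power_le)
  have "s \<le> top_bit n" if "bit n s" for s
    unfolding top_bit_def by (rule Max_ge[OF finite_bits]) (simp add: that)
  then have "take_bit (Suc (top_bit n)) n = n"
    by (intro bit_eqI) (auto simp: bit_take_bit_iff less_Suc_eq_le)
  then show "n < 2 ^ Suc (top_bit n)"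
    by (metis take_bit_nat_less_exp)
qed

locale weight_row =
  fixes t :: "nat \<Rightarrow> nat \<Rightarrow> real" and n :: nat
  assumes n: "n \<ge> 1"
    and nonneg: "\<And>k. k \<le> n \<Longrightarrow> t k n \<ge> 0"
    and total: "(\<Sum>k = 0..n. t k n) = 1"
begin

lemma tail_sum_eq: "m \<le> Suc n \<Longrightarrow> tail_sum t m n = (\<Sum>k | k \<le> n \<and> n < k + m. t k n)"
  unfolding tail_sum_def
  by (rule sum.reindex_bij_witness[of _ "\<lambda>k. n - k" "\<lambda>l. n - l"]) auto

lemma tail_sum_mono: "l \<le> m \<Longrightarrow> m \<le> Suc n \<Longrightarrow> tail_sum t l n \<le> tail_sum t m n"
  unfolding tail_sum_def by (rule sum_mono2) (auto intro: nonneg)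

lemma tail_sum_nonneg: "0 \<le> tail_sum t m n"
  unfolding tail_sum_def by (intro sum_nonneg nonneg) simp

lemma tail_sum_full: "tail_sum t (Suc n) n = 1"
proof -
  have "{k. k \<le> n \<and> n < k + Suc n} = {0..n}" by auto
  then show ?thesis using tail_sum_eq[of "Suc n"] total by simp
qed

lemma tail_sum_le_1: "m \<le> Suc n \<Longrightarrow> tail_sum t m n \<le> 1"
  using tail_sum_mono[of m "Suc n"] tail_sum_full by simp

lemma weights_le_1: "(\<Sum>k = 1..n. t k n) \<le> 1"
proof -
  have "(\<Sum>k = 1..n. t k n) \<le> (\<Sum>k = 0..n. t k n)"
    by (rule sum_mono2) (auto intro: nonneg)
  with total show ?thesis by simp
qed

lemma abs_matrix_transform_le:
  assumes "\<And>k. 1 \<le> k \<Longrightarrow> k \<le> n \<Longrightarrow> \<bar>walsh_sum k f x\<bar> \<le> B" and "0 \<le> B"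
  shows "\<bar>matrix_transform t n f x\<bar> \<le> B"
proof -
  have "\<bar>matrix_transform t n f x\<bar> \<le> (\<Sum>k = 1..n. \<bar>t k n * walsh_sum k f x\<bar>)"
    unfolding matrix_transform_def by (rule sum_abs)
  also have "\<dots> \<le> (\<Sum>k = 1..n. t k n * B)"
    by (rule sum_mono) (auto simp: abs_mult nonneg intro!: mult_left_mono assms(1))
  also have "\<dots> = (\<Sum>k = 1..n. t k n) * B" by (simp add: sum_distrib_right)
  also have "\<dots> \<le> 1 * B" by (intro mult_right_mono weights_le_1 assms(2))
  finally show ?thesis by simp
qed

text \<open>
  The transform reproduces the value P on the window of the last m indices with the weight of this window;
  the remaining weights see values of size at most B.
\<close>

lemma abs_matrix_transform_plateau:
  assumes plateau: "\<And>k. k \<le> n \<Longrightarrow> n < k + m \<Longrightarrow> walsh_sum k f x = P"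
    and bound: "\<And>k. \<bar>walsh_sum k f x\<bar> \<le> B" and m: "m \<le> n"
  shows "tail_sum t m n * \<bar>P\<bar> - (1 - tail_sum t m n) * B \<le> \<bar>matrix_transform t n f x\<bar>"
proof -
  let ?I = "{k. k \<le> n \<and> n < k + m}" and ?J = "{1..n - m}"
  have fin: "finite ?I" by (rule finite_subset[of _ "{..n}"]) auto
  have I: "sum (\<lambda>k. t k n) ?I = tail_sum t m n" using m by (simp add: tail_sum_eq)
  have "{1..n} = ?I \<union> ?J" "?I \<inter> ?J = {}" using m by auto
  then have split: "sum g {1..n} = sum g ?I + sum g ?J" for g :: "nat \<Rightarrow> real"
    using fin by (simp add: sum.union_disjoint)
  have "sum (\<lambda>k. t k n) ?J \<le> 1 - tail_sum t m n"
    using weights_le_1 split[of "\<lambda>k. t k n"] I by simp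
  moreover have "0 \<le> B" using bound[of 0] by simp
  ultimately have "(\<Sum>k\<in>?J. t k n) * B \<le> (1 - tail_sum t m n) * B"
    by (rule mult_right_mono)
  then have J: "(\<Sum>k\<in>?J. t k n * B) \<le> (1 - tail_sum t m n) * B"
    by (simp only: sum_distrib_right)
  have "matrix_transform t n f x = tail_sum t m n * P + (\<Sum>k\<in>?J. t k n * walsh_sum k f x)"
    unfolding matrix_transform_def split I[symmetric] sum_distrib_right
    by (simp add: plateau)
  moreover have "\<bar>\<Sum>k\<in>?J. t k n * walsh_sum k f x\<bar> \<le> (\<Sum>k\<in>?J. t k n * B)"
    by (rule order_trans[OF sum_abs sum_mono])
      (auto simp: abs_mult nonneg intro!: mult_left_mono bound)
  moreover have "\<bar>tail_sum t m n * P\<bar> = tail_sum t m n * \<bar>P\<bar>"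
    by (simp add: abs_mult tail_sum_nonneg)
  ultimately show ?thesis using J by linarith
qed

text \<open>
  With h = 2^(|n| - 1), the sum of the weights at distance h up to 2 h from the end is at most \<open>\<epsilon>\<close>. The weights further
  left number at most 2 h and, by monotonicity, each is at most the average over that range, so their sum
  is at most \<open>2 \<epsilon>\<close>.
\<close>

lemma tail_sum_top_bit:
  assumes mono: "\<And>k. k < n \<Longrightarrow> t k n \<le> t (k + 1) n" and "top_bit n \<ge> 1"
    and step: "tail_sum t (2 ^ top_bit n) n \<le> tail_sum t (2 ^ (top_bit n - 1)) n + \<epsilon>"
  shows "1 - 2 * \<epsilon> \<le> tail_sum t (2 ^ top_bit n) n"
proof -
  define h :: nat where "h = 2 ^ (top_bit n - 1)"
  have h: "2 ^ top_bit n = 2 * h" and "h \<ge> 1"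
    using \<open>top_bit n \<ge> 1\<close> by (simp_all add: h_def flip: power_Suc)
  have n_h: "2 * h \<le> n" "n < 4 * h"
    using top_bit_bounds[OF n] h by simp_all
  have t_mono: "t i n \<le> t j n" if "i \<le> j" "j \<le> n" for i j
    using that
  proof (induction j rule: dec_induct)
    case (step j)
    have "t i n \<le> t j n" using step by simp
    also have "t j n \<le> t (j + 1) n" using step by (intro mono) simp
    finally show ?case by simp
  qed simp
  let ?c = "t (n - 2 * h) n"
  have "real h * ?c \<le> (\<Sum>l = h..<2 * h. t (n - l) n)"
  proof -
    have "(\<Sum>l = h..<2 * h. ?c) \<le> (\<Sum>l = h..<2 * h. t (n - l) n)"
      by (rule sum_mono) (auto intro: t_mono)
    then show ?thesis by simp
  qed
  also have "\<dots> = tail_sum t (2 * h) n - tail_sum t h n"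
  proof -
    have "{..<2 * h} = {..<h} \<union> {h..<2 * h}" by auto
    then show ?thesis unfolding tail_sum_def by (simp add: sum.union_disjoint ivl_disj_int)
  qed
  also have "\<dots> \<le> \<epsilon>" using step h by (simp add: h_def)
  finally have c: "real h * ?c \<le> \<epsilon>" .
  have "1 - tail_sum t (2 * h) n = (\<Sum>l = 2 * h..<Suc n. t (n - l) n)"
  proof -
    have "{..<Suc n} = {..<2 * h} \<union> {2 * h..<Suc n}" using n_h by auto
    then show ?thesis using tail_sum_full
      unfolding tail_sum_def by (simp add: sum.union_disjoint ivl_disj_int)
  qed
  also have "\<dots> \<le> (\<Sum>l = 2 * h..<Suc n. ?c)"
    by (rule sum_mono) (auto intro: t_mono)
  also have "\<dots> = real (Suc n - 2 * h) * ?c" by simp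
  also have "\<dots> \<le> real (2 * h) * ?c"
    using n_h nonneg[of "n - 2 * h"] by (intro mult_right_mono) simp_all
  finally show ?thesis using c by (simp add: h)
qed

end

text \<open>
  For |n| large the sequence \<open>\<omega>\<close> exceeds A, so the quotient hypothesis covers the last A halvings of the
  window. Since all tail sums are at most 1, a quotient below \<open>1 + \<epsilon>\<close> means a loss of at most
  \<open>\<epsilon>\<close>, and the A losses add up to at most \<open>A \<epsilon>\<close>, on top of the \<open>2 \<epsilon>\<close> from
  \<open>tail_sum_top_bit\<close>.
\<close>

lemma tail_mass:
  fixes t :: "nat \<Rightarrow> nat \<Rightarrow> real" and \<omega> :: "nat \<Rightarrow> nat"
  assumes nonneg: "\<And>k n. n \<ge> 1 \<Longrightarrow> k \<le> n \<Longrightarrow> t k n \<ge> 0"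
    and mono: "\<And>k n. n \<ge> 1 \<Longrightarrow> k < n \<Longrightarrow> t k n \<le> t (k + 1) n"
    and total: "\<And>n. n \<ge> 1 \<Longrightarrow> (\<Sum>k = 0..n. t k n) = 1"
    and \<omega>: "filterlim \<omega> at_top sequentially"
    and lim: "has_Delta_limit \<omega> (\<lambda>k n. tail_sum t (2 ^ k) n / tail_sum t (2 ^ (k - 1)) n) 1"
    and "0 < \<delta>"
  shows "\<exists>N. \<forall>n\<ge>1. N \<le> top_bit n \<longrightarrow> 1 - \<delta> \<le> tail_sum t (2 ^ (top_bit n - A)) n"
proof -
  define \<epsilon> where "\<epsilon> = min (1 / 2) (\<delta> / (real A + 2))"
  have \<epsilon>: "0 < \<epsilon>" "\<epsilon> \<le> 1 / 2" "(real A + 2) * \<epsilon> \<le> \<delta>"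
  proof -
    show "0 < \<epsilon>" using \<open>0 < \<delta>\<close> by (simp add: \<epsilon>_def)
    show "\<epsilon> \<le> 1 / 2" unfolding \<epsilon>_def by (rule min.cobounded1)
    have "\<epsilon> \<le> \<delta> / (real A + 2)" by (simp add: \<epsilon>_def)
    then show "(real A + 2) * \<epsilon> \<le> \<delta>" by (simp add: pos_le_divide_eq mult.commute)
  qed
  obtain N0 where N0: "\<And>k n. (k, n) \<in> Delta \<omega> \<Longrightarrow> N0 \<le> top_bit n \<Longrightarrow>
      \<bar>tail_sum t (2 ^ k) n / tail_sum t (2 ^ (k - 1)) n - 1\<bar> < \<epsilon>"
    using lim \<epsilon>(1) unfolding has_Delta_limit_def by fast
  have "eventually (\<lambda>n. A + 1 \<le> \<omega> n) sequentially"
    using \<omega> by (rule filterlim_at_top[THEN iffD1, rule_format])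
  then obtain N1 where N1: "\<And>n. N1 \<le> n \<Longrightarrow> A + 1 \<le> \<omega> n"
    unfolding eventually_sequentially by blast
  have "1 - \<delta> \<le> tail_sum t (2 ^ (top_bit n - A)) n"
    if n: "n \<ge> 1" and big: "max N0 (max N1 (A + 1)) \<le> top_bit n" for n
  proof -
    define L where "L = top_bit n"
    define \<tau> where "\<tau> = (\<lambda>k. tail_sum t (2 ^ k) n)"
    interpret weight_row t n
      by (rule weight_row.intro) (rule n, erule nonneg[OF n], rule total[OF n])
    have L: "N0 \<le> L" "N1 \<le> L" "A + 1 \<le> L" using big by (simp_all add: L_def)
    have "L < 2 ^ L" by (rule less_exp)
    also have pow: "2 ^ L \<le> n" using top_bit_bounds(1)[OF n] by (simp add: L_def)
    finally have "A + 1 \<le> \<omega> n" using L by (intro N1) linarith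
    have step: "\<tau> k \<le> \<tau> (k - 1) + \<epsilon>" if k: "L - A \<le> k" "k \<le> L" for k
    proof -
      have "(k, n) \<in> Delta \<omega>"
        using k n \<open>A + 1 \<le> \<omega> n\<close> L(3) by (simp add: Delta_def flip: L_def)
      then have ratio: "\<bar>\<tau> k / \<tau> (k - 1) - 1\<bar> < \<epsilon>"
        unfolding \<tau>_def using L(1) by (intro N0) (simp_all add: L_def)
      have "\<tau> (k - 1) \<noteq> 0"
      proof
        \<comment> \<open>the quotient would be 0 by the convention for division by 0, and so far from 1\<close>
        assume "\<tau> (k - 1) = 0"
        with ratio \<epsilon>(2) show False by simp
      qed
      moreover have "0 \<le> \<tau> (k - 1)" unfolding \<tau>_def by (rule tail_sum_nonneg)
      ultimately have pos: "0 < \<tau> (k - 1)" by simp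
      have "(2::nat) ^ (k - 1) \<le> 2 ^ L" using k(2) by (intro power_increasing) auto
      then have "(2::nat) ^ (k - 1) \<le> Suc n" using pow by linarith
      then have le1: "\<tau> (k - 1) \<le> 1" unfolding \<tau>_def by (rule tail_sum_le_1)
      have "\<tau> k / \<tau> (k - 1) < 1 + \<epsilon>" using ratio by linarith
      then have "\<tau> k < (1 + \<epsilon>) * \<tau> (k - 1)" using pos by (simp add: pos_divide_less_eq)
      also have "\<dots> = \<tau> (k - 1) + \<epsilon> * \<tau> (k - 1)" by (simp add: distrib_right)
      also have "\<epsilon> * \<tau> (k - 1) \<le> \<epsilon> * 1" using le1 \<epsilon>(1) by (intro mult_left_mono) auto
      finally show ?thesis by simp
    qed
    have "1 - 2 * \<epsilon> \<le> \<tau> L"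
      unfolding \<tau>_def L_def
      by (rule tail_sum_top_bit[OF mono[OF n]])
        (use L(3) step[of L] in \<open>simp_all add: \<tau>_def L_def\<close>)
    moreover have "\<tau> L - real j * \<epsilon> \<le> \<tau> (L - j)" if "j \<le> A" for j
      using that
    proof (induction j)
      case (Suc j)
      have "\<tau> (L - j) \<le> \<tau> (L - j - 1) + \<epsilon>" using Suc.prems by (intro step) auto
      moreover have "\<tau> L - real j * \<epsilon> \<le> \<tau> (L - j)" using Suc by simp
      ultimately show ?case by (simp add: distrib_right)
    qed simp
    from this[OF order_refl] have "\<tau> L - real A * \<epsilon> \<le> \<tau> (L - A)" .
    ultimately show ?thesis using \<epsilon>(3) by (simp add: \<tau>_def L_def distrib_right)
  qed
  then show ?thesis by blast
qed

text \<open>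
  For n = 2^M p with p at most 2^R one has M \<le> |n| \<le> M + R, so a window of length 2^M is at least as long as one of
  length 2^(|n| - R).
\<close>

lemma tail_mass_multiples:
  fixes t :: "nat \<Rightarrow> nat \<Rightarrow> real"
  assumes nonneg: "\<And>k n. n \<ge> 1 \<Longrightarrow> k \<le> n \<Longrightarrow> t k n \<ge> 0"
    and total: "\<And>n. n \<ge> 1 \<Longrightarrow> (\<Sum>k = 0..n. t k n) = 1"
    and mass: "\<forall>n\<ge>1. N \<le> top_bit n \<longrightarrow> \<beta> \<le> tail_sum t (2 ^ (top_bit n - R)) n"
    and p: "1 \<le> p" "p \<le> 2 ^ R" and "N \<le> M"
  shows "\<beta> \<le> tail_sum t (2 ^ M) (2 ^ M * p)"
proof -
  let ?n = "2 ^ M * p"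
  have n: "?n \<ge> 1" using p(1) by simp
  have lower: "2 ^ M \<le> ?n" using p(1) by simp
  have upper: "?n \<le> 2 ^ (M + R)" using p(2) by (simp add: power_add)
  have "(2::nat) ^ M < 2 ^ Suc (top_bit ?n)"
    using lower top_bit_bounds(2)[OF n] by (rule le_less_trans)
  then have "M < Suc (top_bit ?n)" by (rule power_less_imp_less_exp[rotated]) simp
  have "(2::nat) ^ top_bit ?n \<le> 2 ^ (M + R)"
    using top_bit_bounds(1)[OF n] upper by (rule order_trans)
  then have "top_bit ?n \<le> M + R" by (rule power_le_imp_le_exp[rotated]) simp
  interpret weight_row t ?n
    by (rule weight_row.intro) (rule n, erule nonneg[OF n], rule total[OF n])
  have "\<beta> \<le> tail_sum t (2 ^ (top_bit ?n - R)) ?n"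
    using mass n \<open>M < Suc (top_bit ?n)\<close> \<open>N \<le> M\<close> by simp
  also have "\<dots> \<le> tail_sum t (2 ^ M) ?n"
  proof (rule tail_sum_mono)
    show "(2::nat) ^ (top_bit ?n - R) \<le> 2 ^ M"
      using \<open>top_bit ?n \<le> M + R\<close> by (intro power_increasing) auto
    show "2 ^ M \<le> Suc ?n" using lower by (rule le_SucI)
  qed
  finally show ?thesis .
qed

section \<open>The gliding hump\<close>

lemma dilated_block_nonneg:
  assumes "spike C R A"
  shows "0 \<le> dilated_block R A M x"
  using assms rademacher_cases unfolding spike_def dilated_block_def walsh_eq_sign_walsh sign_walsh_shift by simp

lemma integrable_dilated_block:
  "integrable lborel (\<lambda>x. indicator {0..<1} x * dilated_block R A M x)"
proof -
  have "integrable lborel (\<lambda>x. indicator {0..<1} x * walsh k x)" for k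
    by (rule integrable_interval_bounded) simp_all
  then have "integrable lborel (\<lambda>x. \<Sum>k<2 ^ R. A k * (indicator {0..<1} x * walsh (2 ^ M * k) x))"
    by (intro Bochner_Integration.integrable_sum integrable_mult_right)
  then show ?thesis
    unfolding dilated_block_def sum_distrib_left by (simp only: mult.left_commute)
qed

lemma walsh_coeff_0_dilated_block: "walsh_coeff (dilated_block R A M) 0 = A 0"
proof -
  have "(\<Sum>k<2 ^ R. A k * of_bool (2 ^ M * k = 0)) = (\<Sum>k<2 ^ R. if k = 0 then A k else 0)"
    by (rule sum.cong) auto
  then show ?thesis by (simp add: walsh_coeff_dilated_block)
qed

text \<open>
  The mixture converges in L1, so that its Walsh coefficients are the mixtures of the coefficients.
\<close>

lemma geometric_mixture:
  fixes F :: "nat \<Rightarrow> real \<Rightarrow> real"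
  assumes [measurable]: "\<And>j. F j \<in> borel_measurable borel"
    and nonneg: "\<And>j x. 0 \<le> F j x"
    and int: "\<And>j. integrable lborel (\<lambda>x. indicator {0..<1} x * F j x)"
    and mean: "\<And>j. walsh_coeff (F j) 0 = 1"
  defines "f \<equiv> \<lambda>x. \<Sum>j. (1 / 2) ^ j * F j x"
  shows "set_integrable lebesgue {0..<1} f"
    and "(\<lambda>j. (1 / 2) ^ j * walsh_coeff (F j) m) sums walsh_coeff f m"
proof -
  have [measurable]: "f \<in> borel_measurable borel" unfolding f_def by measurable
  define g where "g = (\<lambda>j x. indicator {0..<1} x * ((1 / 2) ^ j * F j x) :: real)"
  have g_eq: "g j = (\<lambda>x. (1 / 2) ^ j * (indicator {0..<1} x * F j x))" for j
    by (simp add: g_def mult_ac)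
  have gint: "integrable lborel (g j)" for j
    unfolding g_eq using int by (rule integrable_mult_right)
  have gpos: "0 \<le> g j x" for j x
    unfolding g_def using nonneg by simp
  have "(\<integral>x. g j x \<partial>lborel) = (1 / 2) ^ j" for j
    using mean[of j] by (simp add: g_eq walsh_coeff_lborel walsh_def)
  then have gsum: "summable (\<lambda>j. \<integral>x. g j x \<partial>lborel)"
    by (simp add: summable_geometric)
  have sum_g: "(\<Sum>j. g j x) = indicator {0..<1} x * f x" for x
    by (cases "x \<in> {0..<1}") (simp_all add: g_def f_def)
  have "integrable lborel (\<lambda>x. (\<Sum>j. g j x) * 1)"
    by (rule sums_integral_nonneg(1)[OF gint gpos gsum]) simp_all
  then show "set_integrable lebesgue {0..<1} f"
    by (simp add: set_integrable_lebesgue_iff sum_g)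
  have "(\<lambda>j. \<integral>x. g j x * walsh m x \<partial>lborel) sums (\<integral>x. (\<Sum>j. g j x) * walsh m x \<partial>lborel)"
    by (rule sums_integral_nonneg(2)[OF gint gpos gsum]) simp_all
  moreover have "(\<integral>x. g j x * walsh m x \<partial>lborel) = (1 / 2) ^ j * walsh_coeff (F j) m" for j
    by (simp add: g_eq walsh_coeff_lborel mult.assoc)
  moreover have "(\<integral>x. (\<Sum>j. g j x) * walsh m x \<partial>lborel) = walsh_coeff f m"
    by (simp add: sum_g walsh_coeff_lborel mult.assoc)
  ultimately show "(\<lambda>j. (1 / 2) ^ j * walsh_coeff (F j) m) sums walsh_coeff f m" by simp
qed

lemma matrix_transform_sums:
  assumes "\<And>m. (\<lambda>j. c j * walsh_coeff (F j) m) sums walsh_coeff f m"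
  shows "(\<lambda>j. c j * matrix_transform t n (F j) x) sums matrix_transform t n f x"
proof -
  have walsh_sum: "(\<lambda>j. c j * walsh_sum q (F j) x) sums walsh_sum q f x" for q
    unfolding walsh_sum_def sum_distrib_left mult.assoc[symmetric]
    by (intro sums_sum sums_mult2 assms)
  have "(\<lambda>j. \<Sum>k = 1..n. t k n * (c j * walsh_sum k (F j) x)) sums matrix_transform t n f x"
    unfolding matrix_transform_def by (intro sums_sum sums_mult walsh_sum)
  then show ?thesis
    by (simp add: matrix_transform_def sum_distrib_left mult.left_commute)
qed

lemma abs_sums_dominant_term:
  fixes b :: "nat \<Rightarrow> real"
  assumes "b sums s" and later: "\<And>i. j < i \<Longrightarrow> \<bar>b i\<bar> \<le> (1 / 2) ^ i"
  shows "\<bar>b j\<bar> - (\<Sum>i<j. \<bar>b i\<bar>) - 2 \<le> \<bar>s\<bar>"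
proof -
  have "(\<lambda>i. b (i + Suc j)) sums (s - (\<Sum>i<Suc j. b i))"
    using assms(1) by (rule sums_split_initial_segment)
  then have tail: "(\<Sum>i. b (i + Suc j)) = s - (\<Sum>i<j. b i) - b j"
    by (simp add: sums_iff)
  have le: "norm (b (i + Suc j)) \<le> (1 / 2) ^ i" for i
  proof -
    have "\<bar>b (i + Suc j)\<bar> \<le> (1 / 2) ^ (i + Suc j)" by (rule later) simp
    also have "\<dots> \<le> (1 / 2) ^ i" by (rule power_decreasing) simp_all
    finally show ?thesis by simp
  qed
  have geo: "summable (\<lambda>i. (1 / 2 :: real) ^ i)" by (simp add: summable_geometric)
  have "norm (\<Sum>i. b (i + Suc j)) \<le> (\<Sum>i. (1 / 2) ^ i)"
    by (rule norm_suminf_le[OF le geo])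
  also have "\<dots> = 2" by (simp add: suminf_geometric)
  finally have "\<bar>s - (\<Sum>i<j. b i) - b j\<bar> \<le> 2" unfolding tail real_norm_def .
  moreover have "\<bar>\<Sum>i<j. b i\<bar> \<le> (\<Sum>i<j. \<bar>b i\<bar>)" by (rule sum_abs)
  ultimately show ?thesis by linarith
qed

lemma limsup_abs_eq_infinity:
  fixes a :: "nat \<Rightarrow> real"
  assumes "\<And>j. \<exists>n\<ge>j. real j \<le> \<bar>a n\<bar>"
  shows "limsup (\<lambda>n. ereal \<bar>a n\<bar>) = \<infinity>"
proof -
  have "(SUP m\<in>{n..}. ereal \<bar>a m\<bar>) = \<infinity>" for n
  proof (rule SUP_PInfty)
    fix k :: nat
    obtain m where "m \<ge> max n k" "real (max n k) \<le> \<bar>a m\<bar>" using assms by blast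
    then show "\<exists>m\<in>{n..}. ereal (real k) \<le> ereal \<bar>a m\<bar>"
      by (intro bexI[of _ m]) simp_all
  qed
  then show ?thesis by (simp add: limsup_INF_SUP)
qed

text \<open>
  The j-th polynomial enters with the weight 2^(-j). The mass outside the window costs a factor of at most 2
  and an error of at most 1 / 2, which the last summand 1 compensates. What is left must exceed j by the contribution of all the other
  polynomials: 2^(R i) for each earlier one, which has 2^(R i) coefficients of absolute value at most 1, and at most 2
  for all later ones together.
\<close>

definition required_height :: "(nat \<Rightarrow> nat) \<Rightarrow> nat \<Rightarrow> real"
  where "required_height R j = 2 ^ Suc j * (real j + 2 + (\<Sum>i<j. 2 ^ R i)) + 1"

text \<open>
  The recursion that chooses the sizes R j and the dilations M j. The required height involves the earlier
  sizes only. After R j is known, M j is taken so large that the frequencies of the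
  earlier dilates lie below 2^(M j), and that the window of length 2^(M j) misses a fraction of the mass
  too small to be felt by values of size 2^(R j).
\<close>

lemma exists_spike_sequence:
  fixes t :: "nat \<Rightarrow> nat \<Rightarrow> real"
  assumes nonneg: "\<And>k n. n \<ge> 1 \<Longrightarrow> k \<le> n \<Longrightarrow> t k n \<ge> 0"
    and total: "\<And>n. n \<ge> 1 \<Longrightarrow> (\<Sum>k = 0..n. t k n) = 1"
    and mass: "\<And>\<delta> A. 0 < \<delta> \<Longrightarrow>
      \<exists>N. \<forall>n\<ge>1. N \<le> top_bit n \<longrightarrow> 1 - \<delta> \<le> tail_sum t (2 ^ (top_bit n - A)) n"
  shows "\<exists>R A M. \<forall>j. spike (required_height R j) (R j) (A j) \<and> j \<le> M j \<and> (\<forall>i<j. M i + R i \<le> M j)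
    \<and> (\<forall>p. 1 \<le> p \<and> p \<le> 2 ^ R j \<longrightarrow> 1 - 1 / 2 ^ Suc (R j) \<le> tail_sum t (2 ^ M j) (2 ^ M j * p))"
proof -
  define P :: "(nat \<Rightarrow> nat \<times> (nat \<Rightarrow> real) \<times> nat) \<Rightarrow> nat \<Rightarrow> nat \<times> (nat \<Rightarrow> real) \<times> nat \<Rightarrow> bool"
    where "P = (\<lambda>D j (R, A, M). spike (required_height (\<lambda>i. fst (D i)) j) R A \<and> j \<le> M
      \<and> (\<forall>i<j. snd (snd (D i)) + fst (D i) \<le> M)
      \<and> (\<forall>p. 1 \<le> p \<and> p \<le> 2 ^ R \<longrightarrow> 1 - 1 / 2 ^ Suc R \<le> tail_sum t (2 ^ M) (2 ^ M * p)))"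
  have "\<exists>D. \<forall>j. P D j (D j)"
  proof (rule dependent_wf_choice[OF wf_less_than])
    fix D D' :: "nat \<Rightarrow> nat \<times> (nat \<Rightarrow> real) \<times> nat" and j r
    assume "\<And>i. (i, j) \<in> less_than \<Longrightarrow> D i = D' i"
    then have eq: "D i = D' i" if "i < j" for i using that by simp
    then have "required_height (\<lambda>i. fst (D i)) j = required_height (\<lambda>i. fst (D' i)) j"
      unfolding required_height_def by simp
    then show "P D j r = P D' j r" using eq unfolding P_def by (auto split: prod.splits)
  next
    fix j and D :: "nat \<Rightarrow> nat \<times> (nat \<Rightarrow> real) \<times> nat"
    obtain R A where spike: "spike (required_height (\<lambda>i. fst (D i)) j) R A"
      using exists_spike by blast
    obtain N where N: "\<forall>n\<ge>1. N \<le> top_bit n \<longrightarrow>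
        1 - 1 / 2 ^ Suc R \<le> tail_sum t (2 ^ (top_bit n - R)) n"
      using mass[of "1 / 2 ^ Suc R" R] by auto
    define M where "M = N + j + (\<Sum>i<j. snd (snd (D i)) + fst (D i))"
    have "snd (snd (D i)) + fst (D i) \<le> M" if "i < j" for i
      using member_le_sum[of i "{..<j}" "\<lambda>i. snd (snd (D i)) + fst (D i)"] that
      unfolding M_def by simp
    moreover have "1 - 1 / 2 ^ Suc R \<le> tail_sum t (2 ^ M) (2 ^ M * p)" if "1 \<le> p" "p \<le> 2 ^ R" for p
      by (rule tail_mass_multiples[OF nonneg total N that]) (simp_all add: M_def)
    ultimately have "P D j (R, A, M)"
      unfolding P_def using spike by (simp add: M_def)
    then show "\<exists>r. P D j r" ..
  qed
  then obtain D where D: "\<And>j. P D j (D j)" by blast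
  show ?thesis
    by (rule exI[of _ "\<lambda>i. fst (D i)"], rule exI[of _ "\<lambda>i. fst (snd (D i))"],
        rule exI[of _ "\<lambda>i. snd (snd (D i))"])
      (use D in \<open>simp add: P_def split_beta\<close>)
qed

theorem theorem4:
  fixes t :: "nat \<Rightarrow> nat \<Rightarrow> real" and \<omega> :: "nat \<Rightarrow> nat"
  assumes "\<And>k n. n \<ge> 1 \<Longrightarrow> k \<le> n \<Longrightarrow> t k n \<ge> 0"
    and "\<And>k n. n \<ge> 1 \<Longrightarrow> k < n \<Longrightarrow> t k n \<le> t (k + 1) n"
    and "\<And>n. n \<ge> 1 \<Longrightarrow> (\<Sum>k = 0..n. t k n) = 1"
    and "mono_on {1..} \<omega>"
    and "\<And>n. n \<ge> 1 \<Longrightarrow> \<omega> n > 0"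
    and "filterlim \<omega> at_top sequentially"
    and "filterlim (\<lambda>n. real (top_bit n) / real (\<omega> n)) at_top sequentially"
    and "has_Delta_limit \<omega> (\<lambda>k n. tail_sum t (2 ^ k) n / tail_sum t (2 ^ (k - 1)) n) 1"
  shows "\<exists>f\<^sub>0 :: real \<Rightarrow> real. set_integrable lebesgue {0..<1} f\<^sub>0 \<and>
    (\<forall>x\<in>{0..<1}. limsup (\<lambda>n. ereal \<bar>matrix_transform t n f\<^sub>0 x\<bar>) = \<infinity>)"
proof -
  have concentration: "\<exists>N. \<forall>n\<ge>1. N \<le> top_bit n \<longrightarrow> 1 - \<delta> \<le> tail_sum t (2 ^ (top_bit n - A)) n"
    if "0 < \<delta>" for \<delta> A
    by (rule tail_mass) (fact assms that)+
  have "\<exists>R A M. \<forall>j. spike (required_height R j) (R j) (A j) \<and> j \<le> M j \<and> (\<forall>i<j. M i + R i \<le> M j)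
    \<and> (\<forall>p. 1 \<le> p \<and> p \<le> 2 ^ R j \<longrightarrow> 1 - 1 / 2 ^ Suc (R j) \<le> tail_sum t (2 ^ M j) (2 ^ M j * p))"
    (is "\<exists>R A M. ?P R A M")
    by (rule exists_spike_sequence) (fact assms concentration)+
  then obtain R A M where "?P R A M" by (elim exE)
  then have spike: "spike (required_height R j) (R j) (A j)" and M_ge: "j \<le> M j"
    and M_sep: "i < j \<Longrightarrow> M i + R i \<le> M j"
    and mass: "1 \<le> p \<Longrightarrow> p \<le> 2 ^ R j \<Longrightarrow> 1 - 1 / 2 ^ Suc (R j) \<le> tail_sum t (2 ^ M j) (2 ^ M j * p)"
    for i j p by simp_all
  have A0: "A j 0 = 1" and A_le: "\<bar>A j k\<bar> \<le> 1" for j k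
    using spike[of j] by (simp_all add: spike_def)
  define F where "F = (\<lambda>j. dilated_block (R j) (A j) (M j))"
  define f where "f = (\<lambda>x. \<Sum>j. (1 / 2) ^ j * F j x)"
  have F: "F j \<in> borel_measurable borel" "0 \<le> F j x"
    "integrable lborel (\<lambda>x. indicator {0..<1} x * F j x)" "walsh_coeff (F j) 0 = 1" for j x
    using dilated_block_nonneg[OF spike] integrable_dilated_block
    by (simp_all add: F_def walsh_coeff_0_dilated_block A0)
  have "\<exists>n\<ge>j. real j \<le> \<bar>matrix_transform t n f x\<bar>" for j x
  proof -
    define u where "u = (\<lambda>i. rademacher (M j + i) x)"
    have "\<exists>p\<le>2 ^ R j. required_height R j \<le> \<bar>\<Sum>k<p. A j k * sign_walsh u k\<bar>"
      by (rule spike_large[OF spike]) (simp add: u_def rademacher_cases)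
    then obtain p where p: "p \<le> 2 ^ R j"
      and big: "required_height R j \<le> \<bar>\<Sum>k<p. A j k * sign_walsh u k\<bar>"
      by (elim exE conjE)
    define Q where "Q = \<bar>\<Sum>k<p. A j k * sign_walsh u k\<bar>"
    have cost: "1 \<le> required_height R j"
      unfolding required_height_def by (simp add: sum_nonneg)
    have "p \<noteq> 0" using big cost by (intro notI) simp
    then have p1: "1 \<le> p" by simp
    define n where "n = 2 ^ M j * p"
    have n1: "1 \<le> n" using p1 by (simp add: n_def)
    have "2 ^ M j * 1 \<le> n" unfolding n_def using p1 by (rule mult_le_mono2)
    then have low: "2 ^ M j \<le> n" by simp
    interpret weight_row t n
      by (rule weight_row.intro) (rule n1, erule assms(1)[OF n1], rule assms(3)[OF n1])
    define b where "b = (\<lambda>i. (1 / 2) ^ i * matrix_transform t n (F i) x)"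
    define \<tau> where "\<tau> = tail_sum t (2 ^ M j) n"

    \<comment> \<open>up to the index n, the partial sums of the later polynomials consist of the mean value only\<close>
    have "\<bar>b i\<bar> \<le> (1 / 2) ^ i" if "j < i" for i
    proof -
      have "n \<le> 2 ^ M j * 2 ^ R j" unfolding n_def using p by (rule mult_le_mono2)
      also have "\<dots> \<le> 2 ^ M i"
        unfolding power_add[symmetric] using M_sep[OF that] by (rule power_increasing) simp
      finally have "\<bar>matrix_transform t n (F i) x\<bar> \<le> 1"
        by (intro abs_matrix_transform_le)
          (simp_all add: F_def walsh_sum_dilated_block_low A0)
      then show ?thesis by (simp add: b_def abs_mult mult_left_le)
    qed
    moreover have "b sums matrix_transform t n f x"
      unfolding b_def f_def by (intro matrix_transform_sums geometric_mixture(2) F)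
    ultimately have dom: "\<bar>b j\<bar> - (\<Sum>i<j. \<bar>b i\<bar>) - 2 \<le> \<bar>matrix_transform t n f x\<bar>"
      by (intro abs_sums_dominant_term)

    \<comment> \<open>the earlier polynomials are bounded by their number of coefficients\<close>
    have early: "(\<Sum>i<j. \<bar>b i\<bar>) \<le> (\<Sum>i<j. 2 ^ R i)"
    proof (rule sum_mono)
      fix i
      have "\<bar>matrix_transform t n (F i) x\<bar> \<le> 2 ^ R i"
        unfolding F_def by (intro abs_matrix_transform_le abs_walsh_sum_dilated_block A_le) simp
      moreover have "(1 / 2 :: real) ^ i \<le> 1" by (simp add: power_le_one)
      ultimately have "(1 / 2) ^ i * \<bar>matrix_transform t n (F i) x\<bar> \<le> 1 * 2 ^ R i"
        by (intro mult_mono) simp_all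
      then show "\<bar>b i\<bar> \<le> 2 ^ R i" by (simp add: b_def abs_mult)
    qed

    have \<tau>: "1 - 1 / 2 ^ Suc (R j) \<le> \<tau>" unfolding \<tau>_def n_def by (rule mass[OF p1 p])
    have "\<tau> * Q - (1 - \<tau>) * 2 ^ R j \<le> \<bar>matrix_transform t n (F j) x\<bar>"
      unfolding \<tau>_def Q_def
    proof (rule abs_matrix_transform_plateau)
      show "walsh_sum k (F j) x = (\<Sum>k<p. A j k * sign_walsh u k)" if "k \<le> n" "n < k + 2 ^ M j" for k
        unfolding F_def u_def
        by (rule walsh_sum_dilated_block_plateau) (use that p in \<open>simp_all add: n_def\<close>)
      show "\<bar>walsh_sum k (F j) x\<bar> \<le> 2 ^ R j" for k
        unfolding F_def by (rule abs_walsh_sum_dilated_block) (rule A_le)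
    qed (rule low)
    moreover have "(1 - \<tau>) * 2 ^ R j \<le> 1 / 2"
    proof -
      have "(1 - \<tau>) * 2 ^ R j \<le> 1 / 2 ^ Suc (R j) * 2 ^ R j"
        using \<tau> by (intro mult_right_mono) simp_all
      then show ?thesis by simp
    qed
    moreover have "1 / 2 * Q \<le> \<tau> * Q"
    proof (rule mult_right_mono)
      have "(1::real) / 2 ^ Suc (R j) \<le> 1 / 2 ^ 1" by (intro divide_left_mono power_increasing) simp_all
      also have "\<dots> = 1 / 2" by simp
      finally show "1 / 2 \<le> \<tau>" using \<tau> by linarith
    qed (simp add: Q_def)
    moreover have "required_height R j \<le> Q" using big by (simp add: Q_def)
    ultimately have "1 / 2 * required_height R j - 1 / 2 \<le> \<bar>matrix_transform t n (F j) x\<bar>" by linarith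
    moreover have "1 / 2 * required_height R j - 1 / 2 = 2 ^ j * (real j + 2 + (\<Sum>i<j. 2 ^ R i))"
      by (simp add: required_height_def add_divide_distrib)
    ultimately have "(1 / 2) ^ j * (2 ^ j * (real j + 2 + (\<Sum>i<j. 2 ^ R i))) \<le> \<bar>b j\<bar>"
      by (simp add: b_def abs_mult)
    then have "real j + 2 + (\<Sum>i<j. 2 ^ R i) \<le> \<bar>b j\<bar>"
      by (simp add: power_one_over)
    with dom early have "real j \<le> \<bar>matrix_transform t n f x\<bar>" by linarith
    moreover have "j \<le> n"
    proof -
      have "j < 2 ^ j" by (rule less_exp)
      also have "\<dots> \<le> 2 ^ M j" using M_ge by (rule power_increasing) simp
      finally show ?thesis using low by linarith
    qed
    ultimately show ?thesis by blast
  qed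
  then have "limsup (\<lambda>n. ereal \<bar>matrix_transform t n f x\<bar>) = \<infinity>" for x
    by (rule limsup_abs_eq_infinity)
  moreover have "set_integrable lebesgue {0..<1} f"
    unfolding f_def by (intro geometric_mixture(1) F)
  ultimately show ?thesis by blast
qed

end
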